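(* Let $\omega=(\omega_n)_{n\in\mathbb{N}}$ be a $\mathbb{Q}$-linearly independent frequency and $J\subset\mathbb{N}$ a finite subset. Then $$\boldsymbol{\lambda}\big(\mathcal{H}_\infty^{J}(\omega)\big)=\int_{\mathbb{T}^{|J|}}\Big|\sum_{n\in J}z_n\Big|\,dz ,$$ where the coordinates of $z\in\mathbb{T}^{|J|}$ are indexed by $J$. Moreover, $$\lim_{x\to\infty}\frac{\boldsymbol{\lambda}\big(\mathcal{H}_\infty^{\le x}(\omega)\big)}{\sqrt{x}}=\frac{\sqrt{\pi}}{2}.$$
   Context: A frequency is a strictly increasing, non-negative real sequence $\omega=(\omega_n)_{n\in\mathbb{N}}$ with $\omega_n\to\infty$; it is $\mathbb{Q}$-linearly independent if the numbers $\omega_n$, $n\in\mathbb{N}$, are linearly independent over $\mathbb{Q}$ (e.g. $\omega_n=\log p_n$, $p_n$ the $n$th prime). For a finite set $J\subset\mathbb{N}$, $\mathcal{H}_\infty^J(\omega)$ is the complex Banach space of all $D(s)=\sum_{n\in J}a_n e^{-\omega_n s}$, $a_n\in\mathbb{C}$, with norm $\|D\|_\infty=\sup_{t\in\mathbb{R}}\big|\sum_{n\in J}a_n e^{-i\omega_n t}\big|$, and for $x\in\mathbb{N}$, $\mathcal{H}_\infty^{\le x}(\omega)=\mathcal{H}_\infty^{\{1,\dots,x\}}(\omega)$. $\mathbb{T}$ is the unit circle in $\mathbb{C}$ and $dz$ is the normalized Lebesgue (Haar) measure on the torus. For a closed subspace $X$ of a complex Banach space $Y$, the relative projection constant is $\boldsymbol{\lambda}(X,Y)=\inf\{\|P\|: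 P\colon Y\to X \text{ bounded linear},\ P|_X=\mathrm{id}_X\}$ (with $\inf\emptyset=\infty$). The (absolute) projection constant of a finite dimensional Banach space $X$ is $\boldsymbol{\lambda}(X)=\sup\boldsymbol{\lambda}(I(X),Y)$, the supremum being over all Banach spaces $Y$ and isometric linear embeddings $I\colon X\to Y$ with $I(X)$ complemented in $Y$. *)

theory Defs
  imports
    "HOL-Analysis.Analysis"
    "HOL-Algebra.Algebraic_Closure_Type"
begin

section \<open>Complex Banach spaces and projection constants\<close>

text \<open>
  Projection constants compare a space with all Banach spaces containing it, so Banach spaces
  are treated as objects with explicit carriers: modules of HOL-Algebra over the field of
  complex numbers, together with a norm. The fields \<open>mult\<close> and \<open>one\<close> which the record of modules
  inherits from rings carry no meaning.
\<close>

record 'b normed_module = "(complex, 'b) module" +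
  nrm :: "'b \<Rightarrow> real"

locale complex_banach_space = module "ring_of_type_algebra :: complex ring" V
  for V :: "('b, 'm) normed_module_scheme" (structure) +
  assumes nrm_nonneg: "x \<in> carrier V \<Longrightarrow> 0 \<le> nrm V x"
    and nrm_eq_0_iff: "x \<in> carrier V \<Longrightarrow> nrm V x = 0 \<longleftrightarrow> x = \<zero>"
    and nrm_smult: "x \<in> carrier V \<Longrightarrow> nrm V (c \<odot>\<^bsub>V\<^esub> x) = cmod c * nrm V x"
    and nrm_triangle: "x \<in> carrier V \<Longrightarrow> y \<in> carrier V \<Longrightarrow> nrm V (x \<oplus> y) \<le> nrm V x + nrm V y"
    and complete: "\<And>\<sigma> :: nat \<Rightarrow> 'b.
      (\<forall>n. \<sigma> n \<in> carrier V) \<Longrightarrow>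
      (\<forall>\<epsilon>>0. \<exists>N. \<forall>m\<ge>N. \<forall>n\<ge>N. nrm V (\<sigma> m \<ominus> \<sigma> n) < \<epsilon>) \<Longrightarrow>
      \<exists>x\<in>carrier V. (\<lambda>n. nrm V (\<sigma> n \<ominus> x)) \<longlonglongrightarrow> 0"

definition linear_maps ::
  "('a, 'm) normed_module_scheme \<Rightarrow> ('b, 'n) normed_module_scheme \<Rightarrow> ('a \<Rightarrow> 'b) set" where
  "linear_maps V W = {f \<in> carrier V \<rightarrow> carrier W.
     (\<forall>x\<in>carrier V. \<forall>y\<in>carrier V. f (x \<oplus>\<^bsub>V\<^esub> y) = f x \<oplus>\<^bsub>W\<^esub> f y) \<and>
     (\<forall>c. \<forall>x\<in>carrier V. f (c \<odot>\<^bsub>V\<^esub> x) = c \<odot>\<^bsub>W\<^esub> f x)}"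

definition bounded_linear_maps ::
  "('a, 'm) normed_module_scheme \<Rightarrow> ('b, 'n) normed_module_scheme \<Rightarrow> ('a \<Rightarrow> 'b) set" where
  "bounded_linear_maps V W =
     {f \<in> linear_maps V W. \<exists>K. \<forall>x\<in>carrier V. nrm W (f x) \<le> K * nrm V x}"

definition isometric_embeddings ::
  "('a, 'm) normed_module_scheme \<Rightarrow> ('b, 'n) normed_module_scheme \<Rightarrow> ('a \<Rightarrow> 'b) set" where
  "isometric_embeddings V W =
     {f \<in> linear_maps V W. \<forall>x\<in>carrier V. nrm W (f x) = nrm V x}"

definition op_norm ::
  "('a, 'm) normed_module_scheme \<Rightarrow> ('b, 'n) normed_module_scheme \<Rightarrow> ('a \<Rightarrow> 'b) \<Rightarrow> ennreal" where
  "op_norm V W f = (SUP x\<in>{x \<in> carrier V. nrm V x \<le> 1}. ennreal (nrm W (f x)))"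

text \<open>
  The subspace \<open>S\<close> carries the norm of \<open>Y\<close>, so bounded operators from \<open>Y\<close> to \<open>S\<close> are the bounded
  operators on \<open>Y\<close> with values in \<open>S\<close>, with the same operator norm.
\<close>

definition bounded_projections ::
  "'b set \<Rightarrow> ('b, 'm) normed_module_scheme \<Rightarrow> ('b \<Rightarrow> 'b) set" where
  "bounded_projections S Y =
     {P \<in> bounded_linear_maps Y Y. P ` carrier Y \<subseteq> S \<and> (\<forall>x\<in>S. P x = x)}"

definition rel_proj_const :: "'b set \<Rightarrow> ('b, 'm) normed_module_scheme \<Rightarrow> ennreal" where
  "rel_proj_const S Y = (INF P\<in>bounded_projections S Y. op_norm Y Y P)"

definition complemented :: "'b set \<Rightarrow> ('b, 'm) normed_module_scheme \<Rightarrow> bool" where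
  "complemented S Y \<longleftrightarrow> bounded_projections S Y \<noteq> {}"

text \<open>
  HOL cannot quantify over the types that carry the superspaces \<open>Y\<close> inside a term. The supremum
  therefore ranges over all Banach spaces whose carrier is a subset of the type \<open>'e + 'y\<close>, where
  \<open>'e\<close> carries \<open>E\<close> and \<open>'y\<close> is an arbitrary type parameter. A statement that holds for all
  types \<open>'y\<close> accounts for all Banach spaces, as a space carried by \<open>'y\<close> has an isometric copy in
  \<open>'e + 'y\<close>. The summand \<open>'e\<close> excludes universes that are too small: if \<open>E\<close> is nonzero, then \<open>'e\<close>
  has at least the cardinality of the continuum and hence has room for a Banach space of the
  cardinality of \<open>\<ell>\<^sub>\<infinity>(\<nat>)\<close>, in which every finite dimensional space embeds isometrically
  with maximal relative projection constant.
\<close>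

definition proj_const :: "'y itself \<Rightarrow> ('e, 'm) normed_module_scheme \<Rightarrow> ennreal" where
  "proj_const _ E =
     (SUP (Y, I) \<in> {(Y :: ('e + 'y) normed_module, I).
         complex_banach_space Y \<and> I \<in> isometric_embeddings E Y \<and> complemented (I ` carrier E) Y}.
       rel_proj_const (I ` carrier E) Y)"


section \<open>Frequencies and spaces of Dirichlet polynomials\<close>

text \<open>Sequences are indexed by the positive integers; the value at \<open>0\<close> is irrelevant.\<close>

definition frequency :: "(nat \<Rightarrow> real) \<Rightarrow> bool" where
  "frequency \<omega> \<longleftrightarrow>
     strict_mono_on {1..} \<omega> \<and> (\<forall>n\<ge>1. 0 \<le> \<omega> n) \<and> filterlim \<omega> at_top sequentially"

text \<open>
  Frequencies are injective on the positive integers, so linear independence of the family is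
  linear independence of its set of values.
\<close>

definition rat_lin_indep :: "(nat \<Rightarrow> real) \<Rightarrow> bool" where
  "rat_lin_indep \<omega> \<longleftrightarrow> module.independent (\<lambda>q::rat. (*) (of_rat q :: real)) (\<omega> ` {1..})"

definition dirichlet_poly :: "(nat \<Rightarrow> real) \<Rightarrow> nat set \<Rightarrow> (nat \<Rightarrow> complex) \<Rightarrow> complex \<Rightarrow> complex" where
  "dirichlet_poly \<omega> J a s = (\<Sum>n\<in>J. a n * exp (- complex_of_real (\<omega> n) * s))"

text \<open>The norm is the supremum over the imaginary axis \<open>s = \<i>t\<close>.\<close>

definition dirichlet_space ::
  "(nat \<Rightarrow> real) \<Rightarrow> nat set \<Rightarrow> (complex \<Rightarrow> complex) normed_module" where
  "dirichlet_space \<omega> J = \<lparr>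
     carrier = range (dirichlet_poly \<omega> J),
     monoid.mult = undefined, one = undefined,
     zero = (\<lambda>s. 0), add = (\<lambda>D E s. D s + E s),
     smult = (\<lambda>c D s. c * D s),
     nrm = (\<lambda>D. SUP t::real. cmod (D (\<i> * complex_of_real t))) \<rparr>"


section \<open>Normalized Lebesgue measure on the torus\<close>

definition circle_measure :: "complex measure" where
  "circle_measure =
     distr (uniform_measure lborel {0..2 * pi}) (restrict_space borel (sphere 0 1)) cis"

end

theory Submission
  imports Defs "HOL-Probability.Probability"
begin

text \<open>
  As the frequencies are linearly independent, Kronecker's theorem says that the points
  \<open>(exp (-\<i> \<omega>\<^sub>n t))\<^sub>n\<close>, \<open>t\<close> real, are dense in the torus. Hence the norm of a Dirichlet
  polynomial is the sum of the moduli of its coefficients (\<open>bohr_sup_norm\<close>), and the space is a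
  copy of complex \<open>\<ell>\<^sub>1\<close> of dimension \<open>|J|\<close>. Both bounds for its projection constant come from
  averaging over the torus. The averages are taken over the finite group of all
  families of \<open>m\<close>-th roots of unity, called the grid below: means over the grid are finite sums,
  so they can be applied to functionals and operators about whose dependence on the point of the
  torus nothing is known, and they tend to the integral as \<open>m\<close> grows (\<open>grid_mean_torus_close\<close>).

  \<^emph>\<open>Upper bound.\<close> Let \<open>\<Psi>\<close> be an isometric embedding of \<open>\<ell>\<^sub>1\<close> into a Banach space \<open>Y\<close>. A point \<open>g\<close> of
  the grid gives the functional \<open>\<Psi> a \<mapsto> \<Sum> a\<^sub>n g\<^sub>n\<close> of norm at most one on the range of \<open>\<Psi>\<close>, which has a
  Hahn-Banach extension \<open>F\<^sub>g\<close> to \<open>Y\<close>. The map that sends \<open>y\<close> to the image under \<open>\<Psi>\<close> of the family of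
  means of \<open>F\<^sub>g y \<cdot> cnj g\<^sub>n\<close> over \<open>g\<close> is a projection, because the coordinates of the grid are
  orthonormal, and its norm is at most the supremum over unimodular \<open>w\<close> of the mean of
  \<open>|\<Sum> w\<^sub>n cnj g\<^sub>n|\<close> (\<open>grid_projection\<close>). By rotation invariance of the torus this is close to the
  integral of \<open>|\<Sum> z\<^sub>n|\<close>.

  \<^emph>\<open>Lower bound.\<close> The superspace consists of all bounded functions on the complex plane, into
  which a Dirichlet polynomial is embedded by restriction to the imaginary axis. A projection
  has coordinate functionals \<open>\<phi>\<^sub>k\<close>. Translating the function \<open>sgn (\<Sum> z\<^sub>n)\<close> by the points \<open>w\<close> of the grid
  gives functions \<open>h\<^sub>w\<close> of norm at most one, and the mean of \<open>\<Sum> w\<^sub>k \<phi>\<^sub>k(h\<^sub>w)\<close> over \<open>w\<close> no longer depends on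
  the projection: averaging turns every projection into the orthogonal one. Up to an error of
  order \<open>1/m\<close> it is the mean of \<open>|\<Sum> g\<^sub>n|\<close>, while it is bounded by the norm of the projection
  (\<open>op_norm_ge\<close>).

  \<^emph>\<open>Asymptotics.\<close> The coordinates \<open>z\<^sub>n\<close> are independent and uniform on the circle. The law of their
  sum \<open>S\<close> is rotation invariant, so the mean of \<open>|S|\<close> is \<open>\<pi>/2\<close> times the mean of \<open>|Re S|\<close>
  (\<open>torus_mean_abs_Re\<close>), and the one-dimensional central limit theorem applies to \<open>Re S\<close>, whose
  summands have variance \<open>1/2\<close>. Bounded second moments turn convergence in law into convergence
  of the first absolute moment (\<open>weak_conv_first_moment\<close>).
\<close>

lemma unimodular_rotation:
  fixes z :: complex
  obtains c where "cmod c = 1" "c * z = cmod z"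
proof (cases "z = 0")
  case False
  then show thesis by (intro that[of "cmod z / z"]) (auto simp: norm_divide)
qed (use that[of 1] in auto)


section \<open>The Hahn-Banach theorem\<close>

context complex_banach_space
begin

lemma smult_in_carrier [simp]: "x \<in> carrier V \<Longrightarrow> c \<odot>\<^bsub>V\<^esub> x \<in> carrier V"
  using smult_closed[of c x] by (simp add: ring_of_type_algebra_def)

lemma smult_add_scalar:
  "x \<in> carrier V \<Longrightarrow> (a + b) \<odot>\<^bsub>V\<^esub> x = a \<odot>\<^bsub>V\<^esub> x \<oplus> b \<odot>\<^bsub>V\<^esub> x"
  using smult_l_distr[of a b x] by (simp add: ring_of_type_algebra_def)

lemma smult_add_vector:
  "x \<in> carrier V \<Longrightarrow> y \<in> carrier V \<Longrightarrow> a \<odot>\<^bsub>V\<^esub> (x \<oplus> y) = a \<odot>\<^bsub>V\<^esub> x \<oplus> a \<odot>\<^bsub>V\<^esub> y"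
  using smult_r_distr[of a x y] by (simp add: ring_of_type_algebra_def)

lemma smult_smult: "x \<in> carrier V \<Longrightarrow> a \<odot>\<^bsub>V\<^esub> (b \<odot>\<^bsub>V\<^esub> x) = (a * b) \<odot>\<^bsub>V\<^esub> x"
  using smult_assoc1[of a b x] by (simp add: ring_of_type_algebra_def)

lemma one_smult [simp]: "x \<in> carrier V \<Longrightarrow> 1 \<odot>\<^bsub>V\<^esub> x = x"
  using smult_one[of x] by (simp add: ring_of_type_algebra_def)

lemma zero_smult [simp]: "x \<in> carrier V \<Longrightarrow> 0 \<odot>\<^bsub>V\<^esub> x = \<zero>"
  using smult_l_null[of x] by (simp add: ring_of_type_algebra_def)

lemma add_uminus_smult [simp]: "x \<in> carrier V \<Longrightarrow> x \<oplus> (-1) \<odot>\<^bsub>V\<^esub> x = \<zero>"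
  using smult_add_scalar[of x 1 "-1"] by simp

lemma smult_zero [simp]: "c \<odot>\<^bsub>V\<^esub> \<zero> = \<zero>"
  using smult_r_null[of c] by (simp add: ring_of_type_algebra_def)

lemma add_cancel:
  assumes "x \<in> carrier V" "y \<in> carrier V"
  shows "(x \<oplus> y) \<oplus> (-1) \<odot>\<^bsub>V\<^esub> x = y"
proof -
  have "(x \<oplus> y) \<oplus> (-1) \<odot>\<^bsub>V\<^esub> x = y \<oplus> (x \<oplus> (-1) \<odot>\<^bsub>V\<^esub> x)"
    using assms by (simp add: M.a_comm[of x y] M.a_assoc del: add_uminus_smult)
  then show ?thesis using assms by simp
qed

lemma nrm_zero [simp]: "nrm V \<zero> = 0"
  using nrm_eq_0_iff[of \<zero>] by simp

text \<open>
  Sublinear functionals for real scalars. They vanish off the carrier, since otherwise the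
  pointwise order would compare irrelevant values and a minimal functional could not exist.
\<close>

definition sublinear :: "('b \<Rightarrow> real) \<Rightarrow> bool" where
  "sublinear p \<longleftrightarrow>
     (\<forall>x\<in>carrier V. \<forall>y\<in>carrier V. p (x \<oplus> y) \<le> p x + p y) \<and>
     (\<forall>x\<in>carrier V. \<forall>t>0. p (complex_of_real t \<odot>\<^bsub>V\<^esub> x) \<le> t * p x) \<and>
     (\<forall>x. x \<notin> carrier V \<longrightarrow> p x = 0)"

lemma sublinear_add:
  "sublinear p \<Longrightarrow> x \<in> carrier V \<Longrightarrow> y \<in> carrier V \<Longrightarrow> p (x \<oplus> y) \<le> p x + p y"
  by (simp add: sublinear_def)

lemma sublinear_scale_le:
  "sublinear p \<Longrightarrow> x \<in> carrier V \<Longrightarrow> t > 0 \<Longrightarrow> p (complex_of_real t \<odot>\<^bsub>V\<^esub> x) \<le> t * p x"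
  by (simp add: sublinear_def)

lemma sublinear_zero:
  assumes "sublinear p"
  shows "p \<zero> = 0"
proof -
  have "t * p \<zero> \<ge> p \<zero>" if "t > 0" for t
    using sublinear_scale_le[OF assms zero_closed that] by simp
  from this[of 2] this[of "1/2"] show ?thesis by simp
qed

lemma sublinear_scale:
  assumes p: "sublinear p" and x: "x \<in> carrier V" and t: "t \<ge> 0"
  shows "p (complex_of_real t \<odot>\<^bsub>V\<^esub> x) = t * p x"
proof (cases "t = 0")
  case True
  then show ?thesis using x sublinear_zero[OF p] by simp
next
  case False
  with t have t: "t > 0" by simp
  let ?y = "complex_of_real t \<odot>\<^bsub>V\<^esub> x"
  have "complex_of_real (inverse t) \<odot>\<^bsub>V\<^esub> ?y = x"
    using t x by (subst smult_smult) (auto simp flip: of_real_mult)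
  then have "p x \<le> inverse t * p ?y"
    using sublinear_scale_le[OF p, of ?y "inverse t"] t x by simp
  then have "t * p x \<le> p ?y" using t by (simp add: field_simps)
  with sublinear_scale_le[OF p x t] show ?thesis by simp
qed

lemma sublinear_uminus:
  assumes p: "sublinear p" and x: "x \<in> carrier V"
  shows "- p ((-1) \<odot>\<^bsub>V\<^esub> x) \<le> p x"
  using sublinear_add[OF p x, of "(-1) \<odot>\<^bsub>V\<^esub> x"] x sublinear_zero[OF p] by simp

text \<open>
  Zorn's lemma: the pointwise infimum of a chain is again sublinear. The infimum is finite
  because \<open>p x\<close> is bounded below by \<open>- p0 (- x)\<close> for every sublinear \<open>p \<le> p0\<close>.
\<close>

lemma sublinear_minimal:
  assumes p0: "sublinear p0"
  obtains p where "sublinear p" "p \<le> p0" "\<And>q. sublinear q \<Longrightarrow> q \<le> p \<Longrightarrow> q = p"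
proof -
  define A where "A = {p. sublinear p \<and> p \<le> p0}"
  have po: "partial_order_on A (relation_of (\<lambda>p q. q \<le> p) A)"
    by (rule partial_order_on_relation_ofI) auto
  have "\<exists>u\<in>A. \<forall>a\<in>C. u \<le> a" if C: "C \<in> Chains (relation_of (\<lambda>p q. q \<le> p) A)" for C
  proof (cases "C = {}")
    case True
    then show ?thesis using p0 by (auto simp: A_def)
  next
    case False
    have CA: "C \<subseteq> A" and tot: "\<And>p q. p \<in> C \<Longrightarrow> q \<in> C \<Longrightarrow> p \<le> q \<or> q \<le> p"
      using C by (auto simp: Chains_def relation_of_def)
    then have sub: "sublinear p" and le0: "p \<le> p0" if "p \<in> C" for p
      using that by (auto simp: A_def)
    define u where "u x = (INF p\<in>C. p x)" for x
    have bdd: "bdd_below ((\<lambda>p. p x) ` C)" for x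
    proof (cases "x \<in> carrier V")
      case True
      show ?thesis
      proof (rule bdd_belowI2)
        fix p assume p: "p \<in> C"
        have "- p0 ((-1) \<odot>\<^bsub>V\<^esub> x) \<le> - p ((-1) \<odot>\<^bsub>V\<^esub> x)"
          using le0[OF p] by (simp add: le_fun_def)
        also have "\<dots> \<le> p x" by (rule sublinear_uminus[OF sub[OF p] True])
        finally show "- p0 ((-1) \<odot>\<^bsub>V\<^esub> x) \<le> p x" .
      qed
    next
      case False
      show ?thesis
      proof (rule bdd_belowI2)
        fix p assume "p \<in> C"
        from sub[OF this] False show "0 \<le> p x" by (simp add: sublinear_def)
      qed
    qed
    have u_le: "u x \<le> p x" if "p \<in> C" for p x
      unfolding u_def by (rule cINF_lower[OF bdd that])
    have u_ge: "c \<le> u x" if "\<And>p. p \<in> C \<Longrightarrow> c \<le> p x" for c x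
      unfolding u_def using False that by (rule cINF_greatest)
    have "sublinear u"
      unfolding sublinear_def
    proof (intro conjI ballI allI impI)
      fix x y assume x: "x \<in> carrier V" and y: "y \<in> carrier V"
      have *: "u (x \<oplus> y) \<le> p x + q y" if p: "p \<in> C" and q: "q \<in> C" for p q
      proof -
        from tot[OF p q] obtain r where r: "r \<in> C" "r \<le> p" "r \<le> q" using p q by auto
        have "u (x \<oplus> y) \<le> r (x \<oplus> y)" using u_le[OF r(1)] .
        also have "\<dots> \<le> r x + r y" by (rule sublinear_add[OF sub[OF r(1)] x y])
        also have "\<dots> \<le> p x + q y" using r(2,3) by (simp add: le_fun_def add_mono)
        finally show ?thesis .
      qed
      have "u (x \<oplus> y) - p x \<le> u y" if "p \<in> C" for p
        by (rule u_ge) (use *[OF that] in \<open>simp add: algebra_simps\<close>)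
      then have "u (x \<oplus> y) - u y \<le> u x"
        by (intro u_ge) (simp add: algebra_simps)
      then show "u (x \<oplus> y) \<le> u x + u y" by simp
    next
      fix x and t :: real assume x: "x \<in> carrier V" and t: "t > 0"
      let ?y = "complex_of_real t \<odot>\<^bsub>V\<^esub> x"
      have "u ?y / t \<le> u x"
      proof (rule u_ge)
        fix p assume p: "p \<in> C"
        have "u ?y \<le> p ?y" by (rule u_le[OF p])
        also have "\<dots> \<le> t * p x" by (rule sublinear_scale_le[OF sub[OF p] x t])
        finally show "u ?y / t \<le> p x" using t by (simp add: field_simps)
      qed
      then show "u ?y \<le> t * u x" using t by (simp add: field_simps)
    next
      fix x assume "x \<notin> carrier V"
      then have zero: "p x = 0" if "p \<in> C" for p
        using sub[OF that] by (simp add: sublinear_def)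
      obtain p where p: "p \<in> C" using False by auto
      show "u x = 0"
        using u_le[OF p, of x] u_ge[of 0 x] zero[OF p] eq_refl[OF zero[symmetric]] by (intro antisym) auto
    qed
    moreover have "u \<le> p0"
      using False u_le le0 by (meson ex_in_conv le_funI le_funD order_trans)
    ultimately show ?thesis using u_le by (auto simp: A_def le_fun_def)
  qed
  from predicate_Zorn[OF po this] obtain p where p: "p \<in> A" "\<forall>q\<in>A. q \<le> p \<longrightarrow> q = p"
    by blast
  show thesis
  proof
    show "sublinear p" "p \<le> p0" using p by (auto simp: A_def)
    fix q assume "sublinear q" "q \<le> p"
    with p show "q = p" by (auto simp: A_def)
  qed
qed

text \<open>
  The infimum over \<open>t \<ge> 0\<close> of \<open>p (x + t a) - t p a\<close> is a sublinear function of \<open>x\<close> below \<open>p\<close>, so by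
  minimality it is \<open>p\<close>. At \<open>t = 1\<close> this is the inequality that is missing for additivity.
\<close>

lemma minimal_sublinear_additive:
  assumes p: "sublinear p" and min: "\<And>q. sublinear q \<Longrightarrow> q \<le> p \<Longrightarrow> q = p"
    and x: "x \<in> carrier V" and a: "a \<in> carrier V"
  shows "p (x \<oplus> a) = p x + p a"
proof -
  let ?s = "\<lambda>t. complex_of_real t \<odot>\<^bsub>V\<^esub> a"
  define q where "q x = (if x \<in> carrier V then INF t\<in>{0..}. p (x \<oplus> ?s t) - t * p a else 0)" for x
  have bdd: "bdd_below ((\<lambda>t. p (x \<oplus> ?s t) - t * p a) ` {0..})" if x: "x \<in> carrier V" for x
  proof (rule bdd_belowI2)
    fix t :: real assume t: "t \<in> {0..}"
    have "p (?s t) \<le> p (x \<oplus> ?s t) + p ((-1) \<odot>\<^bsub>V\<^esub> x)"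
      using sublinear_add[OF p, of "x \<oplus> ?s t" "(-1) \<odot>\<^bsub>V\<^esub> x"] x a
      by (simp add: add_cancel)
    then show "- p ((-1) \<odot>\<^bsub>V\<^esub> x) \<le> p (x \<oplus> ?s t) - t * p a"
      using sublinear_scale[OF p a] t by simp
  qed
  have q_le: "q x \<le> p (x \<oplus> ?s t) - t * p a" if "x \<in> carrier V" "t \<ge> 0" for x t
    unfolding q_def using that by (auto intro!: cINF_lower[OF bdd])
  have q_ge: "c \<le> q x" if "x \<in> carrier V" "\<And>t. t \<ge> 0 \<Longrightarrow> c \<le> p (x \<oplus> ?s t) - t * p a" for c x
    unfolding q_def using that by (auto intro!: cINF_greatest)
  have "sublinear q"
    unfolding sublinear_def
  proof (intro conjI ballI allI impI)
    fix x y assume x: "x \<in> carrier V" and y: "y \<in> carrier V"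
    have *: "q (x \<oplus> y) \<le> (p (x \<oplus> ?s t) - t * p a) + (p (y \<oplus> ?s r) - r * p a)"
      if t: "t \<ge> 0" and r: "r \<ge> 0" for t r
    proof -
      have "(x \<oplus> y) \<oplus> ?s (t + r) = (x \<oplus> ?s t) \<oplus> (y \<oplus> ?s r)"
        using x y a by (simp add: smult_add_scalar M.a_ac)
      then have "p ((x \<oplus> y) \<oplus> ?s (t + r)) \<le> p (x \<oplus> ?s t) + p (y \<oplus> ?s r)"
        using sublinear_add[OF p] x y a by simp
      then show ?thesis
        using q_le[of "x \<oplus> y" "t + r"] x y t r by (simp add: algebra_simps)
    qed
    have "q (x \<oplus> y) - (p (x \<oplus> ?s t) - t * p a) \<le> q y" if "t \<ge> 0" for t
      using *[OF that] by (intro q_ge y) (simp add: algebra_simps)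
    then have "q (x \<oplus> y) - q y \<le> q x"
      by (intro q_ge x) (simp add: algebra_simps)
    then show "q (x \<oplus> y) \<le> q x + q y" by simp
  next
    fix x and c :: real assume x: "x \<in> carrier V" and c: "c > 0"
    let ?y = "complex_of_real c \<odot>\<^bsub>V\<^esub> x"
    have "q ?y / c \<le> q x"
    proof (rule q_ge[OF x])
      fix t :: real assume t: "t \<ge> 0"
      have "?y \<oplus> ?s (c * t) = complex_of_real c \<odot>\<^bsub>V\<^esub> (x \<oplus> ?s t)"
        using x a by (simp add: smult_add_vector smult_smult)
      then have "p (?y \<oplus> ?s (c * t)) = c * p (x \<oplus> ?s t)"
        using sublinear_scale[OF p, of "x \<oplus> ?s t" c] x a c by simp
      with q_le[of ?y "c * t"] x t c have "q ?y \<le> c * (p (x \<oplus> ?s t) - t * p a)"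
        by (simp add: right_diff_distrib mult.assoc)
      then show "q ?y / c \<le> p (x \<oplus> ?s t) - t * p a"
        by (simp only: pos_divide_le_eq[OF c] mult.commute)
    qed
    then show "q ?y \<le> c * q x" using c by (simp add: field_simps)
  qed (simp add: q_def)
  moreover have "q \<le> p"
  proof (rule le_funI)
    fix x show "q x \<le> p x"
      using q_le[of x 0] p a by (cases "x \<in> carrier V") (auto simp: q_def sublinear_def)
  qed
  ultimately have "q = p" by (rule min)
  then have "p x \<le> p (x \<oplus> a) - p a" using q_le[OF x, of 1] a by simp
  with sublinear_add[OF p x a] show ?thesis by simp
qed

text \<open>
  The functional \<open>p0 x\<close>, the infimum over \<open>m \<in> M\<close> of \<open>\<parallel>x + m\<parallel> - f m\<close>, is sublinear, lies below the
  norm, and satisfies \<open>p0 (- m) \<le> - f m\<close> on \<open>M\<close>. Hence any linear functional below \<open>p0\<close> extends \<open>f\<close>,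
  and a minimal sublinear functional below \<open>p0\<close> is linear.
\<close>

lemma hahn_banach_real:
  assumes M: "M \<subseteq> carrier V" "\<zero> \<in> M" "\<And>x y. x \<in> M \<Longrightarrow> y \<in> M \<Longrightarrow> x \<oplus> y \<in> M"
      "\<And>c x. x \<in> M \<Longrightarrow> c \<odot>\<^bsub>V\<^esub> x \<in> M"
    and add: "\<And>x y. x \<in> M \<Longrightarrow> y \<in> M \<Longrightarrow> f (x \<oplus> y) = f x + f y"
    and scale: "\<And>t x. x \<in> M \<Longrightarrow> f (complex_of_real t \<odot>\<^bsub>V\<^esub> x) = t * f x"
    and le: "\<And>x. x \<in> M \<Longrightarrow> f x \<le> nrm V x"
  obtains g :: "'b \<Rightarrow> real" where
    "\<And>x y. x \<in> carrier V \<Longrightarrow> y \<in> carrier V \<Longrightarrow> g (x \<oplus> y) = g x + g y"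
    "\<And>t x. x \<in> carrier V \<Longrightarrow> g (complex_of_real t \<odot>\<^bsub>V\<^esub> x) = t * g x"
    "\<And>x. x \<in> carrier V \<Longrightarrow> g x \<le> nrm V x"
    "\<And>x. x \<in> M \<Longrightarrow> g x = f x"
proof -
  note carr = subsetD[OF M(1)]
  define p0 where "p0 x = (if x \<in> carrier V then INF m\<in>M. nrm V (x \<oplus> m) - f m else 0)" for x
  have bdd: "bdd_below ((\<lambda>m. nrm V (x \<oplus> m) - f m) ` M)" if x: "x \<in> carrier V" for x
  proof (rule bdd_belowI2)
    fix m assume m: "m \<in> M"
    have "nrm V m \<le> nrm V (x \<oplus> m) + nrm V x"
      using nrm_triangle[of "x \<oplus> m" "(-1) \<odot>\<^bsub>V\<^esub> x"] x carr[OF m]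
      by (simp add: nrm_smult add_cancel)
    then show "- nrm V x \<le> nrm V (x \<oplus> m) - f m" using le[OF m] by simp
  qed
  have p0_le: "p0 x \<le> nrm V (x \<oplus> m) - f m" if "x \<in> carrier V" "m \<in> M" for x m
    unfolding p0_def using that by (auto intro!: cINF_lower[OF bdd])
  have p0_ge: "c \<le> p0 x" if "x \<in> carrier V" "\<And>m. m \<in> M \<Longrightarrow> c \<le> nrm V (x \<oplus> m) - f m" for c x
    unfolding p0_def using that M(2) by (auto intro!: cINF_greatest)
  have "sublinear p0"
    unfolding sublinear_def
  proof (intro conjI ballI allI impI)
    fix x y assume x: "x \<in> carrier V" and y: "y \<in> carrier V"
    have *: "p0 (x \<oplus> y) \<le> (nrm V (x \<oplus> m) - f m) + (nrm V (y \<oplus> n) - f n)"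
      if m: "m \<in> M" and n: "n \<in> M" for m n
    proof -
      have "(x \<oplus> y) \<oplus> (m \<oplus> n) = (x \<oplus> m) \<oplus> (y \<oplus> n)"
        using x y carr[OF m] carr[OF n] by (simp add: M.a_ac)
      then have "nrm V ((x \<oplus> y) \<oplus> (m \<oplus> n)) \<le> nrm V (x \<oplus> m) + nrm V (y \<oplus> n)"
        using nrm_triangle x y carr[OF m] carr[OF n] by simp
      then show ?thesis
        using p0_le[of "x \<oplus> y" "m \<oplus> n"] x y M(3)[OF m n] add[OF m n] by simp
    qed
    have "p0 (x \<oplus> y) - (nrm V (x \<oplus> m) - f m) \<le> p0 y" if "m \<in> M" for m
      using *[OF that] by (intro p0_ge y) (simp add: algebra_simps)
    then have "p0 (x \<oplus> y) - p0 y \<le> p0 x"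
      by (intro p0_ge x) (simp add: algebra_simps)
    then show "p0 (x \<oplus> y) \<le> p0 x + p0 y" by simp
  next
    fix x and c :: real assume x: "x \<in> carrier V" and c: "c > 0"
    let ?c = "complex_of_real c"
    have "p0 (?c \<odot>\<^bsub>V\<^esub> x) / c \<le> p0 x"
    proof (rule p0_ge[OF x])
      fix m assume m: "m \<in> M"
      have "?c \<odot>\<^bsub>V\<^esub> x \<oplus> ?c \<odot>\<^bsub>V\<^esub> m = ?c \<odot>\<^bsub>V\<^esub> (x \<oplus> m)"
        using x carr[OF m] by (simp add: smult_add_vector)
      then have "nrm V (?c \<odot>\<^bsub>V\<^esub> x \<oplus> ?c \<odot>\<^bsub>V\<^esub> m) = c * nrm V (x \<oplus> m)"
        using x carr[OF m] c by (simp add: nrm_smult)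
      with p0_le[of "?c \<odot>\<^bsub>V\<^esub> x" "?c \<odot>\<^bsub>V\<^esub> m"] x M(4)[OF m] scale[OF m, of c]
      have "p0 (?c \<odot>\<^bsub>V\<^esub> x) \<le> c * (nrm V (x \<oplus> m) - f m)"
        by (simp add: right_diff_distrib)
      then show "p0 (?c \<odot>\<^bsub>V\<^esub> x) / c \<le> nrm V (x \<oplus> m) - f m"
        by (simp only: pos_divide_le_eq[OF c] mult.commute)
    qed
    then show "p0 (?c \<odot>\<^bsub>V\<^esub> x) \<le> c * p0 x" using c by (simp add: field_simps)
  qed (simp add: p0_def)
  then obtain g where g: "sublinear g" "g \<le> p0" "\<And>q. sublinear q \<Longrightarrow> q \<le> g \<Longrightarrow> q = g"
    using sublinear_minimal by blast
  have g_add: "g (x \<oplus> y) = g x + g y" if "x \<in> carrier V" "y \<in> carrier V" for x y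
    using minimal_sublinear_additive[OF g(1,3)] that by blast
  have g_minus: "g ((-1) \<odot>\<^bsub>V\<^esub> x) = - g x" if "x \<in> carrier V" for x
    using g_add[of x "(-1) \<odot>\<^bsub>V\<^esub> x"] that sublinear_zero[OF g(1)] by simp
  have f_zero: "f \<zero> = 0" using scale[of \<zero> 0] M(2) by simp
  have f_minus: "f ((-1) \<odot>\<^bsub>V\<^esub> x) = - f x" if "x \<in> M" for x
    using scale[OF that, of "-1"] by simp
  have g_le_f: "g ((-1) \<odot>\<^bsub>V\<^esub> x) \<le> - f x" if x: "x \<in> M" for x
  proof -
    have "(-1) \<odot>\<^bsub>V\<^esub> x \<oplus> x = \<zero>" using carr[OF x] by (simp add: M.a_comm)
    then show ?thesis
      using p0_le[of "(-1) \<odot>\<^bsub>V\<^esub> x" x] le_funD[OF g(2), of "(-1) \<odot>\<^bsub>V\<^esub> x"] x carr[OF x] by simp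
  qed
  show thesis
  proof
    show "g (x \<oplus> y) = g x + g y" if "x \<in> carrier V" "y \<in> carrier V" for x y
      using g_add that by blast
    show "g (complex_of_real t \<odot>\<^bsub>V\<^esub> x) = t * g x" if x: "x \<in> carrier V" for t x
    proof (cases "t \<ge> 0")
      case True
      then show ?thesis by (rule sublinear_scale[OF g(1) x])
    next
      case False
      have "complex_of_real t \<odot>\<^bsub>V\<^esub> x = (-1) \<odot>\<^bsub>V\<^esub> (complex_of_real (-t) \<odot>\<^bsub>V\<^esub> x)"
        using x by (simp add: smult_smult)
      then show ?thesis
        using g_minus[of "complex_of_real (-t) \<odot>\<^bsub>V\<^esub> x"] x False
          sublinear_scale[OF g(1) x, of "-t"] by simp
    qed
    show "g x \<le> nrm V x" if "x \<in> carrier V" for x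
      using p0_le[OF that M(2)] le_funD[OF g(2), of x] that f_zero by simp
    show "g x = f x" if x: "x \<in> M" for x
    proof (rule antisym)
      show "f x \<le> g x" using g_le_f[OF x] g_minus carr[OF x] by simp
      have "(-1) \<odot>\<^bsub>V\<^esub> ((-1) \<odot>\<^bsub>V\<^esub> x) = x" using carr[OF x] by (simp add: smult_smult)
      then show "g x \<le> f x" using g_le_f[OF M(4)[OF x, of "-1"]] f_minus[OF x] by simp
    qed
  qed
qed

text \<open>
  The real part of \<open>f\<close> is extended to a real functional \<open>g\<close>, and \<open>g x - \<i> g (\<i> x)\<close> is the
  complex-linear functional with real part \<open>g\<close>. Its modulus at \<open>x\<close> is its real part at a
  unimodular multiple of \<open>x\<close>, which gives the bound.
\<close>

theorem hahn_banach:
  assumes M: "M \<subseteq> carrier V" "\<zero> \<in> M" "\<And>x y. x \<in> M \<Longrightarrow> y \<in> M \<Longrightarrow> x \<oplus> y \<in> M"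
      "\<And>c x. x \<in> M \<Longrightarrow> c \<odot>\<^bsub>V\<^esub> x \<in> M"
    and add: "\<And>x y. x \<in> M \<Longrightarrow> y \<in> M \<Longrightarrow> f (x \<oplus> y) = f x + f y"
    and scale: "\<And>c x. x \<in> M \<Longrightarrow> f (c \<odot>\<^bsub>V\<^esub> x) = c * f x"
    and le: "\<And>x. x \<in> M \<Longrightarrow> cmod (f x) \<le> nrm V x"
  obtains F :: "'b \<Rightarrow> complex" where
    "\<And>x y. x \<in> carrier V \<Longrightarrow> y \<in> carrier V \<Longrightarrow> F (x \<oplus> y) = F x + F y"
    "\<And>c x. x \<in> carrier V \<Longrightarrow> F (c \<odot>\<^bsub>V\<^esub> x) = c * F x"
    "\<And>x. x \<in> carrier V \<Longrightarrow> cmod (F x) \<le> nrm V x"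
    "\<And>x. x \<in> M \<Longrightarrow> F x = f x"
proof -
  obtain g :: "'b \<Rightarrow> real" where
      g_add: "\<And>x y. x \<in> carrier V \<Longrightarrow> y \<in> carrier V \<Longrightarrow> g (x \<oplus> y) = g x + g y"
    and g_scale: "\<And>t x. x \<in> carrier V \<Longrightarrow> g (complex_of_real t \<odot>\<^bsub>V\<^esub> x) = t * g x"
    and g_le: "\<And>x. x \<in> carrier V \<Longrightarrow> g x \<le> nrm V x"
    and g_eq: "\<And>x. x \<in> M \<Longrightarrow> g x = Re (f x)"
  proof (rule hahn_banach_real[of M "\<lambda>x. Re (f x)"])
    show "Re (f x) \<le> nrm V x" if "x \<in> M" for x
      using le[OF that] complex_Re_le_cmod[of "f x"] by simp
  qed (use M add scale in auto)
  define F where "F x = Complex (g x) (- g (\<i> \<odot>\<^bsub>V\<^esub> x))" for x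
  have F_add: "F (x \<oplus> y) = F x + F y" if "x \<in> carrier V" "y \<in> carrier V" for x y
    using that by (simp add: F_def complex_eq_iff smult_add_vector g_add)
  have F_scale: "F (c \<odot>\<^bsub>V\<^esub> x) = c * F x" if x: "x \<in> carrier V" for c x
  proof -
    have *: "g (d \<odot>\<^bsub>V\<^esub> x) = Re d * g x + Im d * g (\<i> \<odot>\<^bsub>V\<^esub> x)" for d
    proof -
      have "d \<odot>\<^bsub>V\<^esub> x = complex_of_real (Re d) \<odot>\<^bsub>V\<^esub> x \<oplus> complex_of_real (Im d) \<odot>\<^bsub>V\<^esub> (\<i> \<odot>\<^bsub>V\<^esub> x)"
        using x complex_eq[of d] by (simp add: smult_smult mult.commute flip: smult_add_scalar)
      then show ?thesis using x by (simp add: g_add g_scale)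
    qed
    show ?thesis
      using x *[of c] *[of "\<i> * c"] by (simp add: F_def complex_eq_iff smult_smult)
  qed
  have F_le: "cmod (F x) \<le> nrm V x" if x: "x \<in> carrier V" for x
  proof -
    obtain c where c: "cmod c = 1" "c * F x = cmod (F x)"
      by (rule unimodular_rotation)
    have "cmod (F x) = Re (F (c \<odot>\<^bsub>V\<^esub> x))" using F_scale[OF x, of c] c by simp
    also have "\<dots> = g (c \<odot>\<^bsub>V\<^esub> x)" by (simp add: F_def)
    also have "\<dots> \<le> nrm V (c \<odot>\<^bsub>V\<^esub> x)" using x by (intro g_le) simp
    also have "\<dots> = nrm V x" using x c by (simp add: nrm_smult)
    finally show ?thesis .
  qed
  have "F x = f x" if x: "x \<in> M" for x
    using g_eq[OF x] g_eq[OF M(4)[OF x, of "\<i>"]] scale[OF x, of "\<i>"]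
    by (simp add: F_def complex_eq_iff)
  with F_add F_scale F_le show thesis by (rule that)
qed

end

section \<open>Means over families of roots of unity\<close>

abbreviation unity_roots :: "nat \<Rightarrow> complex set" where
  "unity_roots m \<equiv> {z. z ^ m = 1}"

abbreviation grid :: "nat set \<Rightarrow> nat \<Rightarrow> (nat \<Rightarrow> complex) set" where
  "grid J m \<equiv> (\<Pi>\<^sub>E n\<in>J. unity_roots m)"

definition grid_mean :: "nat set \<Rightarrow> nat \<Rightarrow> ((nat \<Rightarrow> complex) \<Rightarrow> 'a::real_vector) \<Rightarrow> 'a" where
  "grid_mean J m f = (\<Sum>g\<in>grid J m. f g) /\<^sub>R real (card (grid J m))"

lemma norm_unity_root:
  assumes "m > 0" "z \<in> unity_roots m"
  shows "cmod z = 1"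
  using assms power_eq_1_iff[of z m] by auto

lemma cnj_mult_unity_root:
  assumes "m > 0" "z \<in> unity_roots m"
  shows "cnj z * z = 1" "z * cnj z = 1"
  using norm_unity_root[OF assms] complex_norm_square[of z] by (auto simp: mult.commute)

lemma finite_grid: "finite J \<Longrightarrow> m > 0 \<Longrightarrow> finite (grid J m)"
  by (intro finite_PiE finite_roots_unity) auto

lemma card_grid_pos: "finite J \<Longrightarrow> m > 0 \<Longrightarrow> card (grid J m) > 0"
  using finite_grid[of J m] by (auto simp: card_gt_0_iff PiE_eq_empty_iff intro!: exI[of _ 1])

lemma grid_mean_const: "finite J \<Longrightarrow> m > 0 \<Longrightarrow> grid_mean J m (\<lambda>_. c) = (c :: 'a::real_vector)"
  using card_grid_pos[of J m] by (simp add: grid_mean_def sum_constant_scaleR)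

lemma grid_mean_mono:
  assumes "\<And>g. g \<in> grid J m \<Longrightarrow> f g \<le> (h g :: real)"
  shows "grid_mean J m f \<le> grid_mean J m h"
  unfolding grid_mean_def using assms by (auto intro!: mult_left_mono sum_mono)

lemma grid_mean_cong:
  "(\<And>g. g \<in> grid J m \<Longrightarrow> f g = h g) \<Longrightarrow> grid_mean J m f = grid_mean J m h"
  unfolding grid_mean_def by simp

lemma norm_grid_mean: "norm (grid_mean J m f) \<le> grid_mean J m (\<lambda>g. norm (f g))"
  unfolding grid_mean_def by (auto simp: divide_right_mono intro!: mult_left_mono norm_sum)

lemma grid_mean_add: "grid_mean J m (\<lambda>g. f g + h g) = grid_mean J m f + grid_mean J m h"
  unfolding grid_mean_def by (simp add: sum.distrib scaleR_add_right)

lemma grid_mean_diff: "grid_mean J m (\<lambda>g. f g - h g) = grid_mean J m f - grid_mean J m h"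
  unfolding grid_mean_def by (simp add: sum_subtractf scaleR_diff_right)

lemma grid_mean_mult_left:
  "grid_mean J m (\<lambda>g. c * f g) = c * (grid_mean J m f :: 'a::real_algebra)"
  unfolding grid_mean_def by (simp flip: sum_distrib_left)

lemma grid_mean_sum: "grid_mean J m (\<lambda>g. \<Sum>k\<in>A. f k g) = (\<Sum>k\<in>A. grid_mean J m (f k))"
  unfolding grid_mean_def by (simp add: sum.swap[of _ A] flip: scaleR_sum_right)

lemma grid_mean_of_real: "grid_mean J m (\<lambda>g. complex_of_real (f g)) = of_real (grid_mean J m f)"
  unfolding grid_mean_def by (simp add: scaleR_conv_of_real)

lemma abs_grid_mean_diff_le:
  assumes "finite J" "m > 0" "\<And>g. g \<in> grid J m \<Longrightarrow> \<bar>f g - h g\<bar> \<le> (c::real)"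
  shows "\<bar>grid_mean J m f - grid_mean J m h\<bar> \<le> c"
proof -
  have "\<bar>grid_mean J m f - grid_mean J m h\<bar> \<le> grid_mean J m (\<lambda>g. \<bar>f g - h g\<bar>)"
    using norm_grid_mean[of J m "\<lambda>g. f g - h g"] by (simp add: grid_mean_diff)
  also have "\<dots> \<le> grid_mean J m (\<lambda>_. c)" by (intro grid_mean_mono assms)
  also have "\<dots> = c" by (intro grid_mean_const assms)
  finally show ?thesis .
qed

text \<open>
  The map \<open>g \<mapsto> h \<cdot> cnj g\<close> is \<open>g \<mapsto> h / g\<close> in the group of grid points, hence an involution of the
  grid.
\<close>

lemma grid_mean_reflect:
  assumes m: "m > 0" and h: "\<And>n. n \<in> J \<Longrightarrow> h n \<in> unity_roots m"
  shows "grid_mean J m (\<lambda>g. f (\<lambda>n\<in>J. h n * cnj (g n))) = grid_mean J m f"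
proof -
  let ?i = "\<lambda>g. \<lambda>n\<in>J. h n * cnj (g n)"
  have inv: "?i (?i g) = g" if "g \<in> grid J m" for g
  proof (rule PiE_ext[of _ J])
    show "?i (?i g) \<in> (\<Pi>\<^sub>E n\<in>J. UNIV)" "g \<in> (\<Pi>\<^sub>E n\<in>J. UNIV)" using that by auto
    fix n assume n: "n \<in> J"
    have "h n * cnj (h n) = 1" using cnj_mult_unity_root[OF m h[OF n]] by simp
    then show "?i (?i g) n = g n" using n by simp
  qed
  have clo: "?i g \<in> grid J m" if g: "g \<in> grid J m" for g
  proof (rule iffD2[OF restrict_PiE_iff], rule ballI)
    fix n assume n: "n \<in> J"
    have "g n ^ m = 1" using g n by (auto simp: PiE_def Pi_def)
    then show "h n * cnj (g n) \<in> unity_roots m"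
      using h[OF n] by (simp add: power_mult_distrib flip: complex_cnj_power)
  qed
  have "bij_betw ?i (grid J m) (grid J m)"
  proof (rule bij_betw_byWitness[where f' = ?i])
    show "?i ` grid J m \<subseteq> grid J m" using clo by blast
    then show "?i ` grid J m \<subseteq> grid J m" .
  qed (use inv in blast)+
  from sum.reindex_bij_betw[OF this, of f] show ?thesis by (simp add: grid_mean_def)
qed

lemma grid_mean_translate:
  assumes m: "m > 0" and h: "\<And>n. n \<in> J \<Longrightarrow> h n \<in> unity_roots m"
  shows "grid_mean J m (\<lambda>g. f (\<lambda>n\<in>J. h n * g n)) = grid_mean J m f"
proof -
  have "grid_mean J m (\<lambda>g. f (\<lambda>n\<in>J. h n * g n)) =
        grid_mean J m (\<lambda>g. f (\<lambda>n\<in>J. h n * (\<lambda>n\<in>J. 1 * cnj (g n)) n))"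
    by (rule grid_mean_reflect[symmetric, OF m]) simp
  also have "\<dots> = grid_mean J m (\<lambda>g. f (\<lambda>n\<in>J. h n * cnj (g n)))"
    by (intro grid_mean_cong arg_cong[where f = f]) auto
  also have "\<dots> = grid_mean J m f" by (rule grid_mean_reflect[OF m h])
  finally show ?thesis .
qed

text \<open>
  For \<open>j \<noteq> k\<close>, multiplying the coordinate \<open>j\<close> by a root of unity \<open>z \<noteq> 1\<close> multiplies the mean by \<open>z\<close>
  without changing it. Such a root exists because \<open>m \<ge> 2\<close>.
\<close>

lemma grid_mean_orthogonal:
  assumes J: "finite J" and m: "m \<ge> 2" and j: "j \<in> J" and k: "k \<in> J"
  shows "grid_mean J m (\<lambda>g. g j * cnj (g k)) = (if j = k then 1 else 0)"
proof (cases "j = k")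
  case True
  have "grid_mean J m (\<lambda>g. g j * cnj (g k)) = grid_mean J m (\<lambda>g. 1)"
    using cnj_mult_unity_root[of m] m True k by (intro grid_mean_cong) (auto simp: PiE_def Pi_def)
  then show ?thesis using True grid_mean_const[OF J, of m "1::complex"] m by simp
next
  case False
  have "\<not> unity_roots m \<subseteq> {1::complex}"
    using card_roots_unity_eq[of m] m card_mono[of "{1::complex}" "unity_roots m"] by auto
  then obtain z :: complex where z: "z ^ m = 1" "z \<noteq> 1" by auto
  define h where "h n = (if n = j then z else 1)" for n
  have "grid_mean J m (\<lambda>g. g j * cnj (g k)) =
        grid_mean J m (\<lambda>g. (\<lambda>n\<in>J. h n * g n) j * cnj ((\<lambda>n\<in>J. h n * g n) k))"
    by (rule grid_mean_translate[symmetric]) (use m z in \<open>auto simp: h_def\<close>)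
  also have "\<dots> = z * grid_mean J m (\<lambda>g. g j * cnj (g k))"
    using False j k by (simp add: h_def mult.assoc flip: grid_mean_mult_left)
  finally show ?thesis using z False by simp
qed

lemma norm_cis_diff_le: "cmod (cis x - cis y) \<le> \<bar>x - y\<bar>"
proof -
  have "cis x - cis y = cis y * (cis (x - y) - 1)"
    by (simp add: algebra_simps cis_mult)
  then have "cmod (cis x - cis y) = cmod (cis (x - y) - 1)" by (simp add: norm_mult)
  also have "\<dots> \<le> \<bar>x - y\<bar>"
  proof -
    have "(cmod (cis t - 1))\<^sup>2 \<le> t\<^sup>2" for t :: real
    proof -
      have "(cmod (cis t - 1))\<^sup>2 = 2 - 2 * cos t"
        using sin_cos_squared_add[of t] by (subst cmod_power2) (simp add: power2_eq_square algebra_simps)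
      also have "\<dots> = 4 * (sin (t / 2))\<^sup>2"
        using cos_double_sin[of "t / 2"] by simp
      also have "\<dots> \<le> 4 * (t / 2)\<^sup>2"
        using abs_sin_x_le_abs_x[of "t / 2"] by (simp only: abs_le_square_iff)
      finally show ?thesis by (simp add: power2_eq_square)
    qed
    from this[of "x - y"] show ?thesis
      using abs_le_square_iff[of "cmod (cis (x - y) - 1)" "x - y"] by simp
  qed
  finally show ?thesis .
qed

lemma unity_root_near:
  assumes z: "cmod z = 1" and m: "m > 0"
  obtains r where "r \<in> unity_roots m" "cmod (z - r) \<le> 2 * pi / m"
proof -
  let ?t = "Arg z * m / (2 * pi)"
  define r where "r = cis (2 * pi * of_int \<lfloor>?t\<rfloor> / m)"
  have "real m * (2 * pi * of_int \<lfloor>?t\<rfloor> / m) = 2 * pi * of_int \<lfloor>?t\<rfloor>"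
    using m by simp
  then have "r ^ m = cis (2 * pi * of_int \<lfloor>?t\<rfloor>)"
    unfolding r_def by (simp only: Complex.DeMoivre)
  also have "\<dots> = 1" by (rule cis_multiple_2pi) simp
  finally have "r \<in> unity_roots m" by simp
  moreover have "cmod (z - r) \<le> 2 * pi / m"
  proof -
    have "z = cis (Arg z)" using z by (metis Arg_eq cis_conv_exp mult_1 of_real_1 norm_zero zero_neq_one)
    then have "cmod (z - r) \<le> \<bar>Arg z - 2 * pi * of_int \<lfloor>?t\<rfloor> / m\<bar>"
      using norm_cis_diff_le unfolding r_def by metis
    also have "\<dots> = 2 * pi / m * \<bar>?t - of_int \<lfloor>?t\<rfloor>\<bar>"
      using m by (simp add: abs_mult[symmetric] field_simps flip: abs_of_pos)
    also have "\<dots> \<le> 2 * pi / m * 1"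
      by (intro mult_left_mono, linarith, simp)
    finally show ?thesis by simp
  qed
  ultimately show thesis by (rule that)
qed

text \<open>
  If \<open>w\<close> is itself a point of the grid, the two means agree by translation invariance; in
  general \<open>w\<close> is at distance at most \<open>2 \<pi> / m\<close> from the grid in each coordinate.
\<close>

lemma grid_mean_rotation_close:
  assumes J: "finite J" and m: "m > 0" and w: "\<And>n. n \<in> J \<Longrightarrow> cmod (w n) = 1"
  shows "\<bar>grid_mean J m (\<lambda>g. cmod (\<Sum>n\<in>J. w n * g n)) - grid_mean J m (\<lambda>g. cmod (\<Sum>n\<in>J. g n))\<bar>
           \<le> card J * (2 * pi / m)"
proof -
  have "\<forall>n\<in>J. \<exists>r. r \<in> unity_roots m \<and> cmod (w n - r) \<le> 2 * pi / m"
    using unity_root_near[OF w m] by metis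
  then obtain r where r: "\<And>n. n \<in> J \<Longrightarrow> r n \<in> unity_roots m"
    "\<And>n. n \<in> J \<Longrightarrow> cmod (w n - r n) \<le> 2 * pi / m" by metis
  have "grid_mean J m (\<lambda>g. cmod (\<Sum>n\<in>J. g n)) =
        grid_mean J m (\<lambda>g. cmod (\<Sum>n\<in>J. (\<lambda>n\<in>J. r n * g n) n))"
    by (rule grid_mean_translate[symmetric, OF m r(1)])
  also have "\<dots> = grid_mean J m (\<lambda>g. cmod (\<Sum>n\<in>J. r n * g n))" by simp
  finally show ?thesis
  proof (simp only:, intro abs_grid_mean_diff_le J m)
    fix g assume g: "g \<in> grid J m"
    have "\<bar>cmod (\<Sum>n\<in>J. w n * g n) - cmod (\<Sum>n\<in>J. r n * g n)\<bar>
        \<le> cmod ((\<Sum>n\<in>J. w n * g n) - (\<Sum>n\<in>J. r n * g n))" by (rule norm_triangle_ineq3)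
    also have "\<dots> = cmod (\<Sum>n\<in>J. (w n - r n) * g n)"
      by (simp add: sum_subtractf left_diff_distrib)
    also have "\<dots> \<le> (\<Sum>n\<in>J. 2 * pi / m)"
    proof (rule sum_norm_le)
      fix n assume n: "n \<in> J"
      then have "cmod (g n) = 1" using g norm_unity_root[OF m] by (auto simp: PiE_def Pi_def)
      then show "cmod ((w n - r n) * g n) \<le> 2 * pi / m"
        using r(2)[OF n] by (simp add: norm_mult)
    qed
    finally show "\<bar>cmod (\<Sum>n\<in>J. w n * g n) - cmod (\<Sum>n\<in>J. r n * g n)\<bar> \<le> card J * (2 * pi / m)"
      by simp
  qed
qed

section \<open>Rotations of the torus\<close>

lemma space_circle_measure [simp]: "space circle_measure = sphere 0 1"
  by (simp add: circle_measure_def space_restrict_space)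

lemma sets_circle_measure [measurable_cong]:
  "sets circle_measure = sets (restrict_space borel (sphere 0 1))"
  by (simp add: circle_measure_def)

lemma cis_borel_measurable [measurable]: "cis \<in> borel_measurable borel"
  by (intro borel_measurable_continuous_onI continuous_intros)

lemma cis_measurable_circle:
  "cis \<in> measurable (uniform_measure lborel {0..2 * pi}) (restrict_space borel (sphere 0 1))"
  by (rule measurable_restrict_space2) auto

lemma prob_space_uniform_angle: "prob_space (uniform_measure lborel {0..2 * pi})"
  by (rule prob_space_uniform_measure) auto

interpretation circle: prob_space circle_measure
  unfolding circle_measure_def
  by (rule prob_space.prob_space_distr[OF prob_space_uniform_angle cis_measurable_circle])

lemma measurable_circle_borel:
  "f \<in> borel_measurable borel \<Longrightarrow> f \<in> borel_measurable circle_measure"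
  by (simp add: measurable_cong_sets[OF sets_circle_measure refl] measurable_restrict_space1)

lemma emeasure_lborel_translate:
  fixes S :: "real set"
  assumes S: "S \<in> sets borel"
  shows "emeasure lborel {t. t + a \<in> S} = emeasure lborel S"
proof -
  have "emeasure lborel S = emeasure (distr lborel borel ((+) a)) S"
    by (simp add: lborel_distr_plus)
  also have "\<dots> = emeasure lborel ((+) a -` S)"
    using S by (subst emeasure_distr) auto
  also have "(+) a -` S = {t. t + a \<in> S}" by (auto simp: add.commute)
  finally show ?thesis ..
qed

text \<open>
  Translation by \<open>a\<close> moves the part of the period that leaves the interval at its right end by
  one period back to its left end. Half-open intervals make the pieces disjoint.
\<close>

lemma emeasure_periodic_translate:
  fixes B :: "real set"
  assumes B: "B \<in> sets borel" and per: "\<And>t. t + 2 * pi \<in> B \<longleftrightarrow> t \<in> B"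
    and a: "0 \<le> a" "a \<le> 2 * pi"
  shows "emeasure lborel ({0<..2 * pi} \<inter> {t. t + a \<in> B}) = emeasure lborel ({0<..2 * pi} \<inter> B)"
proof -
  have "emeasure lborel ({0<..2 * pi} \<inter> {t. t + a \<in> B}) = emeasure lborel {t. t + a \<in> {a<..a + 2 * pi} \<inter> B}"
    by (rule arg_cong[where f = "emeasure lborel"]) auto
  also have "\<dots> = emeasure lborel ({a<..a + 2 * pi} \<inter> B)"
    using B by (intro emeasure_lborel_translate) auto
  also have "{a<..a + 2 * pi} \<inter> B = ({a<..2 * pi} \<inter> B) \<union> ({2 * pi<..a + 2 * pi} \<inter> B)"
    using a by auto
  also have "emeasure lborel \<dots> = emeasure lborel ({a<..2 * pi} \<inter> B) + emeasure lborel ({2 * pi<..a + 2 * pi} \<inter> B)"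
    using B by (intro plus_emeasure[symmetric]) auto
  also have "emeasure lborel ({2 * pi<..a + 2 * pi} \<inter> B) =
             emeasure lborel {t. t + 2 * pi \<in> {2 * pi<..a + 2 * pi} \<inter> B}"
    using B by (intro emeasure_lborel_translate[symmetric]) auto
  also have "{t. t + 2 * pi \<in> {2 * pi<..a + 2 * pi} \<inter> B} = {0<..a} \<inter> B"
    using per by auto
  also have "emeasure lborel ({a<..2 * pi} \<inter> B) + emeasure lborel ({0<..a} \<inter> B) =
             emeasure lborel (({a<..2 * pi} \<inter> B) \<union> ({0<..a} \<inter> B))"
    using B by (intro plus_emeasure) auto
  also have "({a<..2 * pi} \<inter> B) \<union> ({0<..a} \<inter> B) = {0<..2 * pi} \<inter> B"
    using a by auto
  finally show ?thesis .
qed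

lemma emeasure_circle:
  assumes A: "A \<in> sets circle_measure"
  shows "emeasure circle_measure A = emeasure lborel ({0<..2 * pi} \<inter> cis -` A) / ennreal (2 * pi)"
    and "cis -` A \<in> sets borel"
proof -
  have A': "A \<in> sets (restrict_space borel (sphere 0 1))" using A by (simp add: sets_circle_measure)
  then obtain A0 where A0: "A0 \<in> sets borel" "A = sphere 0 1 \<inter> A0"
    by (auto simp: sets_restrict_space)
  have "cis -` A = cis -` A0" using A0 by auto
  with measurable_sets[OF cis_borel_measurable A0(1)] show meas: "cis -` A \<in> sets borel" by simp
  have "emeasure circle_measure A = emeasure (uniform_measure lborel {0..2 * pi}) (cis -` A)"
    unfolding circle_measure_def using emeasure_distr[OF cis_measurable_circle A'] by simp
  also have "\<dots> = emeasure lborel ({0..2 * pi} \<inter> cis -` A) / ennreal (2 * pi)"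
    using meas by (subst emeasure_uniform_measure) auto
  also have "emeasure lborel ({0..2 * pi} \<inter> cis -` A) = emeasure lborel ({0<..2 * pi} \<inter> cis -` A)"
  proof (rule emeasure_eq_AE)
    have "AE t in lborel. t \<noteq> (0::real)" by (rule AE_lborel_singleton)
    then show "AE t in lborel. t \<in> {0..2 * pi} \<inter> cis -` A \<longleftrightarrow> t \<in> {0<..2 * pi} \<inter> cis -` A"
      by eventually_elim auto
  qed (use meas in auto)
  finally show "emeasure circle_measure A = emeasure lborel ({0<..2 * pi} \<inter> cis -` A) / ennreal (2 * pi)" .
qed

lemma rotation_measurable:
  assumes "cmod w = 1"
  shows "(\<lambda>z. w * z) \<in> measurable circle_measure circle_measure"
proof -
  have "(\<lambda>z. w * z) \<in> measurable circle_measure (restrict_space borel (sphere 0 1))"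
  proof (rule measurable_restrict_space2)
    show "(\<lambda>z. w * z) \<in> borel_measurable circle_measure"
      by (intro measurable_circle_borel) simp
  qed (use assms in \<open>auto simp: norm_mult\<close>)
  then show ?thesis by (simp add: measurable_cong_sets[OF refl sets_circle_measure])
qed

text \<open>
  In the angle, the rotation by \<open>w = cis a\<close> is the translation by \<open>a\<close>, and the preimage of a set
  under \<open>cis\<close> is \<open>2 \<pi>\<close>-periodic.
\<close>

lemma circle_measure_rotate:
  assumes w: "cmod w = 1"
  shows "distr circle_measure circle_measure (\<lambda>z. w * z) = circle_measure"
proof (rule measure_eqI)
  obtain a where a: "0 \<le> a" "a \<le> 2 * pi" "w = cis a"
  proof -
    have "w = cis (Arg2pi w)" using w Arg2pi_eq[of w] by (simp add: cis_conv_exp)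
    with Arg2pi_ge_0[of w] Arg2pi_lt_2pi[of w] show thesis by (intro that[of "Arg2pi w"]) auto
  qed
  fix A assume "A \<in> sets (distr circle_measure circle_measure (\<lambda>z. w * z))"
  then have A: "A \<in> sets circle_measure" by simp
  let ?A = "(\<lambda>z. w * z) -` A \<inter> space circle_measure"
  have "emeasure (distr circle_measure circle_measure (\<lambda>z. w * z)) A = emeasure circle_measure ?A"
    by (rule emeasure_distr[OF rotation_measurable[OF w] A])
  also have "\<dots> = emeasure lborel ({0<..2 * pi} \<inter> cis -` ?A) / ennreal (2 * pi)"
    by (rule emeasure_circle(1)[OF measurable_sets[OF rotation_measurable[OF w] A]])
  also have "cis -` ?A = {t. t + a \<in> cis -` A}"
    by (auto simp: a(3) cis_mult add.commute)
  also have "emeasure lborel ({0<..2 * pi} \<inter> {t. t + a \<in> cis -` A}) = emeasure lborel ({0<..2 * pi} \<inter> cis -` A)"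
  proof (rule emeasure_periodic_translate[OF emeasure_circle(2)[OF A] _ a(1,2)])
    show "t + 2 * pi \<in> cis -` A \<longleftrightarrow> t \<in> cis -` A" for t
      by (simp flip: cis_mult)
  qed
  also have "\<dots> / ennreal (2 * pi) = emeasure circle_measure A"
    by (rule emeasure_circle(1)[OF A, symmetric])
  finally show "emeasure (distr circle_measure circle_measure (\<lambda>z. w * z)) A = emeasure circle_measure A" .
qed simp

abbreviation torus :: "nat set \<Rightarrow> (nat \<Rightarrow> complex) measure" where
  "torus J \<equiv> (\<Pi>\<^sub>M n\<in>J. circle_measure)"

interpretation torus: product_prob_space "\<lambda>_::nat. circle_measure" UNIV ..

lemma prob_space_torus: "prob_space (torus J)"
  by (intro prob_space_PiM circle.prob_space_axioms)

lemma torus_rotation_measurable: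
  assumes "\<And>n. n \<in> J \<Longrightarrow> cmod (w n) = 1"
  shows "(\<lambda>z. \<lambda>n\<in>J. w n * z n) \<in> measurable (torus J) (torus J)"
proof (rule measurable_restrict)
  fix n assume n: "n \<in> J"
  from measurable_compose[OF measurable_component_singleton[OF n] rotation_measurable[OF assms[OF n]]]
  show "(\<lambda>z. w n * z n) \<in> measurable (torus J) circle_measure" .
qed

lemma torus_rotate:
  assumes J: "finite J" and w: "\<And>n. n \<in> J \<Longrightarrow> cmod (w n) = 1"
  shows "distr (torus J) (torus J) (\<lambda>z. \<lambda>n\<in>J. w n * z n) = torus J"
proof (rule product_sigma_finite.PiM_eqI)
  fix A assume A: "\<And>n. n \<in> J \<Longrightarrow> A n \<in> sets circle_measure"
  let ?B = "\<lambda>n. (\<lambda>z. w n * z) -` A n \<inter> space circle_measure"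
  have "emeasure (distr (torus J) (torus J) (\<lambda>z. \<lambda>n\<in>J. w n * z n)) (Pi\<^sub>E J A) =
        emeasure (torus J) ((\<lambda>z. \<lambda>n\<in>J. w n * z n) -` Pi\<^sub>E J A \<inter> space (torus J))"
    by (rule emeasure_distr[OF torus_rotation_measurable[OF w]]) (use A J in auto)
  also have "(\<lambda>z. \<lambda>n\<in>J. w n * z n) -` Pi\<^sub>E J A \<inter> space (torus J) = Pi\<^sub>E J ?B"
    by (auto simp: space_PiM PiE_iff)
  also have "emeasure (torus J) (Pi\<^sub>E J ?B) = (\<Prod>n\<in>J. emeasure circle_measure (?B n))"
    using measurable_sets[OF rotation_measurable[OF w] A] by (intro torus.emeasure_PiM[OF J])
  also have "\<dots> = (\<Prod>n\<in>J. emeasure circle_measure (A n))"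
  proof (rule prod.cong[OF refl])
    fix n assume n: "n \<in> J"
    show "emeasure circle_measure (?B n) = emeasure circle_measure (A n)"
      using emeasure_distr[OF rotation_measurable[OF w[OF n]] A[OF n]]
      by (simp add: circle_measure_rotate[OF w[OF n]])
  qed
  finally show "emeasure (distr (torus J) (torus J) (\<lambda>z. \<lambda>n\<in>J. w n * z n)) (Pi\<^sub>E J A) =
      (\<Prod>n\<in>J. emeasure circle_measure (A n))" .
qed (use J in \<open>auto intro: torus.product_sigma_finite_axioms\<close>)

lemma norm_torus_coordinate: "z \<in> space (torus J) \<Longrightarrow> n \<in> J \<Longrightarrow> cmod (z n) = 1"
  by (auto simp: space_PiM PiE_iff)

lemma torus_coordinate_measurable: "n \<in> J \<Longrightarrow> (\<lambda>z. z n) \<in> borel_measurable (torus J)"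
  by (rule measurable_compose[OF measurable_component_singleton])
     (auto intro: measurable_circle_borel)

lemma torus_sum_measurable:
  "(\<lambda>z. \<Sum>n\<in>J. w n * z n) \<in> borel_measurable (torus J)"
  by (intro borel_measurable_sum borel_measurable_times torus_coordinate_measurable) auto

lemma torus_norm_sum_measurable:
  "(\<lambda>z. cmod (\<Sum>n\<in>J. w n * z n)) \<in> borel_measurable (torus J)"
  by (rule measurable_compose[OF torus_sum_measurable borel_measurable_norm])

lemma torus_integrable:
  assumes "\<And>n. n \<in> J \<Longrightarrow> cmod (w n) = 1"
  shows "integrable (torus J) (\<lambda>z. cmod (\<Sum>n\<in>J. w n * z n))"
proof (rule finite_measure.integrable_const_bound[where B = "real (card J)"])
  show "finite_measure (torus J)" using prob_space_torus by (rule prob_space.axioms)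
  show "AE z in torus J. norm (cmod (\<Sum>n\<in>J. w n * z n)) \<le> real (card J)"
  proof (rule AE_I2)
    fix z assume z: "z \<in> space (torus J)"
    have "cmod (\<Sum>n\<in>J. w n * z n) \<le> (\<Sum>n\<in>J. 1)"
      by (rule sum_norm_le) (simp add: norm_mult assms norm_torus_coordinate[OF z])
    then show "norm (cmod (\<Sum>n\<in>J. w n * z n)) \<le> real (card J)" by simp
  qed
  show "(\<lambda>z. cmod (\<Sum>n\<in>J. w n * z n)) \<in> borel_measurable (torus J)"
    by (rule torus_norm_sum_measurable)
qed

lemma torus_integral_rotate:
  fixes f :: "(nat \<Rightarrow> complex) \<Rightarrow> real"
  assumes J: "finite J" and w: "\<And>n. n \<in> J \<Longrightarrow> cmod (w n) = 1"
    and f: "f \<in> borel_measurable (torus J)"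
  shows "(\<integral>z. f (\<lambda>n\<in>J. w n * z n) \<partial>torus J) = (\<integral>z. f z \<partial>torus J)"
proof -
  have "(\<integral>z. f z \<partial>torus J) = (\<integral>z. f z \<partial>distr (torus J) (torus J) (\<lambda>z. \<lambda>n\<in>J. w n * z n))"
    by (simp add: torus_rotate[OF J w])
  also have "\<dots> = (\<integral>z. f (\<lambda>n\<in>J. w n * z n) \<partial>torus J)"
    by (rule integral_distr[OF torus_rotation_measurable[OF w] f])
  finally show ?thesis ..
qed

lemma torus_mean_norm_rotate:
  assumes J: "finite J" and w: "\<And>n. n \<in> J \<Longrightarrow> cmod (w n) = 1"
  shows "(\<integral>z. cmod (\<Sum>n\<in>J. w n * z n) \<partial>torus J) = (\<integral>z. cmod (\<Sum>n\<in>J. z n) \<partial>torus J)"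
  using torus_integral_rotate[OF J w, where f = "\<lambda>z. cmod (\<Sum>n\<in>J. z n)"]
    torus_norm_sum_measurable[of "\<lambda>_. 1" J] by simp

text \<open>
  By rotation invariance the integral does not change if the integrand is rotated by a grid
  point \<open>g\<close>; averaging over \<open>g\<close>, it is the integral over \<open>z\<close> of the mean of \<open>|\<Sum> g\<^sub>n z\<^sub>n|\<close>, and this
  mean is almost independent of \<open>z\<close>.
\<close>

theorem grid_mean_torus_close:
  assumes J: "finite J" and m: "m > 0"
  shows "\<bar>(\<integral>z. cmod (\<Sum>n\<in>J. z n) \<partial>torus J) - grid_mean J m (\<lambda>g. cmod (\<Sum>n\<in>J. g n))\<bar>
           \<le> card J * (2 * pi / m)"
proof -
  interpret T: prob_space "torus J" by (rule prob_space_torus)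
  let ?A = "\<lambda>z. grid_mean J m (\<lambda>g. cmod (\<Sum>n\<in>J. g n * z n))"
  let ?a = "grid_mean J m (\<lambda>g. cmod (\<Sum>n\<in>J. g n))"
  have root: "cmod (g n) = 1" if "g \<in> grid J m" "n \<in> J" for g n
    using that norm_unity_root[OF m, of "g n"] by (auto simp: PiE_iff)
  have int: "integrable (torus J) (\<lambda>z. cmod (\<Sum>n\<in>J. g n * z n))" if "g \<in> grid J m" for g
    by (rule torus_integrable[OF root[OF that]])
  have int_A: "integrable (torus J) ?A"
    unfolding grid_mean_def using int by auto
  have "(\<integral>z. cmod (\<Sum>n\<in>J. z n) \<partial>torus J) = grid_mean J m (\<lambda>g. \<integral>z. cmod (\<Sum>n\<in>J. z n) \<partial>torus J)"
    by (rule grid_mean_const[OF J m, symmetric])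
  also have "\<dots> = grid_mean J m (\<lambda>g. \<integral>z. cmod (\<Sum>n\<in>J. g n * z n) \<partial>torus J)"
    by (intro grid_mean_cong torus_mean_norm_rotate[symmetric] J root)
  also have "\<dots> = (\<integral>z. ?A z \<partial>torus J)"
    unfolding grid_mean_def using int by (simp add: Bochner_Integration.integral_sum)
  finally have "(\<integral>z. cmod (\<Sum>n\<in>J. z n) \<partial>torus J) - ?a = (\<integral>z. ?A z - ?a \<partial>torus J)"
    using int_A by (simp add: T.prob_space)
  also have "\<bar>\<dots>\<bar> \<le> card J * (2 * pi / m)"
  proof -
    have "\<bar>\<integral>z. ?A z - ?a \<partial>torus J\<bar> \<le> (\<integral>z. \<bar>?A z - ?a\<bar> \<partial>torus J)"
      using integral_norm_bound[of "torus J" "\<lambda>z. ?A z - ?a"] by simp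
    also have "\<dots> \<le> (\<integral>z. card J * (2 * pi / m) \<partial>torus J)"
    proof (rule integral_mono)
      show "integrable (torus J) (\<lambda>z. \<bar>?A z - ?a\<bar>)" using int_A by auto
      fix z assume z: "z \<in> space (torus J)"
      show "\<bar>?A z - ?a\<bar> \<le> card J * (2 * pi / m)"
        using grid_mean_rotation_close[OF J m, of z] norm_torus_coordinate[OF z]
        by (simp add: mult.commute)
    qed auto
    finally show ?thesis by (simp add: T.prob_space)
  qed
  finally show ?thesis .
qed

section \<open>The mean modulus of a sum of independent points of the circle\<close>

lemma measure_circle_space [simp]: "measure circle_measure (sphere 0 1) = 1"
  using circle.prob_space by simp

lemma integral_abs_cos: "((\<lambda>t. \<bar>cos t\<bar>) has_integral 4) {0..2 * pi}"
proof -
  have pos: "((\<lambda>t. \<bar>cos t\<bar>) has_integral (sin b - sin a)) {a..b}"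
    if "a \<le> b" "\<And>t. t \<in> {a..b} \<Longrightarrow> cos t \<ge> 0" for a b :: real
  proof -
    have "(cos has_integral (sin b - sin a)) {a..b}"
      by (rule fundamental_theorem_of_calculus[OF that(1)])
         (auto intro!: derivative_eq_intros simp flip: has_real_derivative_iff_has_vector_derivative)
    then show ?thesis by (rule has_integral_eq[rotated]) (simp add: that(2))
  qed
  have neg: "((\<lambda>t. \<bar>cos t\<bar>) has_integral (sin a - sin b)) {a..b}"
    if "a \<le> b" "\<And>t. t \<in> {a..b} \<Longrightarrow> cos t \<le> 0" for a b :: real
  proof -
    have "((\<lambda>t. - cos t) has_integral (- sin b - (- sin a))) {a..b}"
      by (rule fundamental_theorem_of_calculus[OF that(1)])
         (auto intro!: derivative_eq_intros simp flip: has_real_derivative_iff_has_vector_derivative)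
    then have "((\<lambda>t. \<bar>cos t\<bar>) has_integral (- sin b - (- sin a))) {a..b}"
      by (rule has_integral_eq[rotated]) (simp add: that(2))
    then show ?thesis by simp
  qed
  have sin3: "sin (3 * pi / 2) = - 1" using sin_3over2_pi by (simp add: mult.commute)
  have 1: "((\<lambda>t. \<bar>cos t\<bar>) has_integral 1) {0..pi/2}"
    using pos[of 0 "pi/2"] by (simp add: cos_ge_zero)
  have "cos t \<le> 0" if "t \<in> {pi/2..3*pi/2}" for t
    using cos_ge_zero[of "t - pi"] that by (simp add: cos_diff field_simps)
  then have 2: "((\<lambda>t. \<bar>cos t\<bar>) has_integral 2) {pi/2..3*pi/2}"
    using neg[of "pi/2" "3*pi/2"] by (simp add: sin3)
  have "cos t \<ge> 0" if "t \<in> {3*pi/2..2*pi}" for t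
    using cos_ge_zero[of "t - 2 * pi"] that by (simp add: cos_diff field_simps)
  then have 3: "((\<lambda>t. \<bar>cos t\<bar>) has_integral 1) {3*pi/2..2*pi}"
    using pos[of "3*pi/2" "2*pi"] by (simp add: sin3)
  have "((\<lambda>t. \<bar>cos t\<bar>) has_integral 1 + 2) {0..3*pi/2}"
    by (rule has_integral_combine[OF _ _ 1 2]) auto
  from has_integral_combine[OF _ _ this 3] show ?thesis by simp
qed

lemma circle_mean_abs_Re: "(\<integral>z. \<bar>Re z\<bar> \<partial>circle_measure) = 2 / pi"
proof -
  have unif: "uniform_measure lborel {0..2 * pi} = density lborel (\<lambda>t. ennreal (indicator {0..2 * pi} t / (2 * pi)))"
    by (auto simp: uniform_measure_def divide_ennreal[symmetric] ennreal_indicator intro!: arg_cong[where f = "density lborel"])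
  have meas: "(\<lambda>z. \<bar>Re z\<bar>) \<in> borel_measurable (restrict_space borel (sphere 0 1))"
    by (intro measurable_restrict_space1) simp
  have "(\<integral>z. \<bar>Re z\<bar> \<partial>circle_measure) = (\<integral>t. \<bar>cos t\<bar> \<partial>uniform_measure lborel {0..2 * pi})"
    unfolding circle_measure_def by (subst integral_distr[OF cis_measurable_circle meas]) simp
  also have "\<dots> = (\<integral>t. (indicator {0..2 * pi} t / (2 * pi)) *\<^sub>R \<bar>cos t\<bar> \<partial>lborel)"
    unfolding unif by (rule integral_density) auto
  also have "\<dots> = (\<integral>t. indicator {0..2 * pi} t *\<^sub>R \<bar>cos t\<bar> \<partial>lborel) / (2 * pi)"
    by (subst Bochner_Integration.integral_divide_zero[symmetric]) simp
  also have "(\<integral>t. indicator {0..2 * pi} t *\<^sub>R \<bar>cos t\<bar> \<partial>lborel) = integral {0..2 * pi} (\<lambda>t. \<bar>cos t\<bar>)"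
  proof -
    have "set_integrable lborel {0..2 * pi} (\<lambda>t. \<bar>cos t\<bar>)"
      unfolding set_integrable_def by (intro borel_integrable_compact continuous_intros) auto
    from set_borel_integral_eq_integral(2)[OF this] show ?thesis
      by (simp add: set_lebesgue_integral_def)
  qed
  also have "\<dots> = 4" using integral_abs_cos by (rule integral_unique)
  finally show ?thesis by simp
qed

lemma circle_integral_rotate:
  fixes f :: "complex \<Rightarrow> real"
  assumes w: "cmod w = 1" and f: "f \<in> borel_measurable borel"
  shows "(\<integral>z. f (w * z) \<partial>circle_measure) = (\<integral>z. f z \<partial>circle_measure)"
  using integral_distr[OF rotation_measurable[OF w] measurable_circle_borel[OF f]]
  by (simp add: circle_measure_rotate[OF w])

lemma Re_complex_of_real_mult: "Re (complex_of_real a * z) = a * Re z"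
  by simp

text \<open>
  By rotation invariance \<open>s\<close> may be taken to be a nonnegative real number.
\<close>

lemma circle_mean_abs_Re_mult: "(\<integral>w. \<bar>Re (w * s)\<bar> \<partial>circle_measure) = 2 / pi * cmod s"
proof -
  obtain c where c: "cmod c = 1" "c * s = cmod s" by (rule unimodular_rotation)
  have "cnj c * c = 1" using complex_norm_square[of c] c(1) by (simp add: mult.commute)
  then have "w * s = cmod s * (cnj c * w)" for w
    unfolding c(2)[symmetric] by (simp add: algebra_simps)
  then have "(\<integral>w. \<bar>Re (w * s)\<bar> \<partial>circle_measure) = (\<integral>w. cmod s * \<bar>Re (cnj c * w)\<bar> \<partial>circle_measure)"
    by (simp only: Re_complex_of_real_mult abs_mult abs_norm_cancel)
  also have "\<dots> = cmod s * (\<integral>w. \<bar>Re w\<bar> \<partial>circle_measure)"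
    using c circle_integral_rotate[of "cnj c" "\<lambda>z. \<bar>Re z\<bar>"] by simp
  finally show ?thesis by (simp add: circle_mean_abs_Re)
qed

text \<open>
  Multiplying the sum \<open>S z\<close> by an independent uniform point \<open>w\<close> of the circle does not change its
  law. Integrating \<open>|Re (w S z)|\<close> first over \<open>w\<close> gives \<open>2/\<pi> \<cdot> |S z|\<close>, and integrating it first over
  \<open>z\<close> gives the mean of \<open>|Re S|\<close>.
\<close>

lemma torus_mean_abs_Re:
  assumes J: "finite J"
  shows "(\<integral>z. \<bar>Re (\<Sum>n\<in>J. z n)\<bar> \<partial>torus J) = 2 / pi * (\<integral>z. cmod (\<Sum>n\<in>J. z n) \<partial>torus J)"
proof -
  interpret T: prob_space "torus J" by (rule prob_space_torus)
  interpret P: pair_prob_space circle_measure "torus J" ..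
  let ?f = "\<lambda>w z. \<bar>Re (w * (\<Sum>n\<in>J. z n))\<bar>"
  have S: "(\<lambda>z. \<Sum>n\<in>J. z n) \<in> borel_measurable (torus J)"
    using torus_sum_measurable[of "\<lambda>_. 1" J] by simp
  have S_pair: "(\<lambda>x. \<Sum>n\<in>J. snd x n) \<in> borel_measurable (circle_measure \<Otimes>\<^sub>M torus J)"
    by (rule measurable_compose[OF measurable_snd S])
  have w_pair: "fst \<in> borel_measurable (circle_measure \<Otimes>\<^sub>M torus J)"
    by (rule measurable_compose[OF measurable_fst, of "\<lambda>x. x", simplified])
       (rule measurable_circle_borel, simp)
  have meas: "(\<lambda>x. ?f (fst x) (snd x)) \<in> borel_measurable (circle_measure \<Otimes>\<^sub>M torus J)"
    using borel_measurable_times[OF w_pair S_pair] by measurable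
  have int: "integrable (circle_measure \<Otimes>\<^sub>M torus J) (\<lambda>x. ?f (fst x) (snd x))"
  proof (rule P.integrable_const_bound[OF AE_I2 meas, where B = "real (card J)"])
    fix x assume x: "x \<in> space (circle_measure \<Otimes>\<^sub>M torus J)"
    have "?f (fst x) (snd x) \<le> cmod (fst x * (\<Sum>n\<in>J. snd x n))" by (rule abs_Re_le_cmod)
    also have "\<dots> = cmod (\<Sum>n\<in>J. snd x n)" using x by (auto simp: norm_mult space_pair_measure)
    also have "\<dots> \<le> (\<Sum>n\<in>J. 1)"
      by (rule sum_norm_le) (use x in \<open>auto simp: norm_torus_coordinate space_pair_measure\<close>)
    finally show "norm (?f (fst x) (snd x)) \<le> real (card J)" by simp
  qed
  have Re_meas: "(\<lambda>z. \<bar>Re (\<Sum>n\<in>J. z n)\<bar>) \<in> borel_measurable (torus J)"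
    using S by measurable
  have "2 / pi * (\<integral>z. cmod (\<Sum>n\<in>J. z n) \<partial>torus J) = (\<integral>z. (\<integral>w. ?f w z \<partial>circle_measure) \<partial>torus J)"
    by (simp only: circle_mean_abs_Re_mult Bochner_Integration.integral_mult_right_zero)
  also have "\<dots> = (\<integral>w. (\<integral>z. ?f w z \<partial>torus J) \<partial>circle_measure)"
    by (rule P.Fubini_integral) (use int in \<open>simp add: case_prod_beta'\<close>)
  also have "\<dots> = (\<integral>w. (\<integral>z. \<bar>Re (\<Sum>n\<in>J. z n)\<bar> \<partial>torus J) \<partial>circle_measure)"
  proof (rule Bochner_Integration.integral_cong[OF refl])
    fix w assume "w \<in> space circle_measure"
    then have w: "cmod w = 1" by simp
    show "(\<integral>z. ?f w z \<partial>torus J) = (\<integral>z. \<bar>Re (\<Sum>n\<in>J. z n)\<bar> \<partial>torus J)"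
      using torus_integral_rotate[OF J w Re_meas] by (simp add: sum_distrib_left del: Re_sum)
  qed
  also have "\<dots> = (\<integral>z. \<bar>Re (\<Sum>n\<in>J. z n)\<bar> \<partial>torus J)" by simp
  finally show ?thesis ..
qed

text \<open>
  Weak convergence controls the bounded function \<open>min |x| K\<close>, and the truncation costs at most
  \<open>B / K\<close> uniformly in \<open>n\<close>, since \<open>|x| - min |x| K \<le> x\<^sup>2 / K\<close>.
\<close>

lemma weak_conv_first_moment:
  fixes \<mu> :: "nat \<Rightarrow> real measure"
  assumes \<mu>: "\<And>n. real_distribution (\<mu> n)" and M: "real_distribution M"
    and conv: "weak_conv_m \<mu> M"
    and sq: "\<And>n. integrable (\<mu> n) (\<lambda>x. x\<^sup>2)" "integrable M (\<lambda>x. x\<^sup>2)"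
    and bound: "\<And>n. (\<integral>x. x\<^sup>2 \<partial>\<mu> n) \<le> B" "(\<integral>x. x\<^sup>2 \<partial>M) \<le> B"
  shows "(\<lambda>n. \<integral>x. \<bar>x\<bar> \<partial>\<mu> n) \<longlonglongrightarrow> (\<integral>x. \<bar>x\<bar> \<partial>M)"
proof -
  have trunc: "\<bar>(\<integral>x. \<bar>x\<bar> \<partial>N) - (\<integral>x. min \<bar>x\<bar> K \<partial>N)\<bar> \<le> B / K"
    if N: "real_distribution N" and int: "integrable N (\<lambda>x. x\<^sup>2)" and le: "(\<integral>x. x\<^sup>2 \<partial>N) \<le> B"
      and K: "K > 0" for N and K :: real
  proof -
    interpret N: real_distribution N by (rule N)
    have int1: "integrable N (\<lambda>x. \<bar>x\<bar>)"
      using N.square_integrable_imp_integrable[OF _ int] by simp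
    have int2: "integrable N (\<lambda>x. min \<bar>x\<bar> K)"
      by (rule N.integrable_const_bound[where B = K]) (use K in auto)
    have "\<bar>(\<integral>x. \<bar>x\<bar> \<partial>N) - (\<integral>x. min \<bar>x\<bar> K \<partial>N)\<bar> = \<bar>\<integral>x. \<bar>x\<bar> - min \<bar>x\<bar> K \<partial>N\<bar>"
      using int1 int2 by simp
    also have "\<dots> \<le> (\<integral>x. \<bar>\<bar>x\<bar> - min \<bar>x\<bar> K\<bar> \<partial>N)" by (rule integral_abs_bound)
    also have "\<dots> \<le> (\<integral>x. x\<^sup>2 / K \<partial>N)"
    proof (rule integral_mono)
      fix x :: real
      show "\<bar>\<bar>x\<bar> - min \<bar>x\<bar> K\<bar> \<le> x\<^sup>2 / K"
      proof (cases "\<bar>x\<bar> \<ge> K")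
        case True
        then have "\<bar>x\<bar> * K \<le> \<bar>x\<bar> * \<bar>x\<bar>" by (intro mult_left_mono) auto
        then have "\<bar>x\<bar> \<le> x\<^sup>2 / K" using K by (simp add: pos_le_divide_eq power2_eq_square)
        moreover have "\<bar>\<bar>x\<bar> - min \<bar>x\<bar> K\<bar> \<le> \<bar>x\<bar>" using True K by simp
        ultimately show ?thesis by simp
      next
        case False
        then show ?thesis using K by simp
      qed
    qed (use int int1 int2 in auto)
    also have "\<dots> \<le> B / K" using le K by (simp add: divide_right_mono)
    finally show ?thesis .
  qed
  have lim: "(\<lambda>n. \<integral>x. min \<bar>x\<bar> K \<partial>\<mu> n) \<longlonglongrightarrow> (\<integral>x. min \<bar>x\<bar> K \<partial>M)" if "K > 0" for K
    by (rule weak_conv_imp_integral_bdd_continuous_conv[OF \<mu> M conv, where B = K])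
       (use that in \<open>auto intro!: continuous_intros\<close>)
  show ?thesis
  proof (rule LIMSEQ_I)
    fix r :: real assume r: "r > 0"
    define K where "K = 3 * (\<bar>B\<bar> + 1) / r"
    have K: "K > 0" using r by (simp add: K_def)
    have BK: "B / K < r / 3"
    proof -
      have "B / K = r * B / (3 * (\<bar>B\<bar> + 1))" by (simp add: K_def)
      also have "\<dots> < r / 3" using r by (simp add: field_simps) (auto simp: abs_if mult_strict_left_mono)
      finally show ?thesis .
    qed
    from LIMSEQ_D[OF lim[OF K], of "r / 3"] r obtain N where
      N: "\<And>n. n \<ge> N \<Longrightarrow> \<bar>(\<integral>x. min \<bar>x\<bar> K \<partial>\<mu> n) - (\<integral>x. min \<bar>x\<bar> K \<partial>M)\<bar> < r / 3" by auto
    show "\<exists>N. \<forall>n\<ge>N. norm ((\<integral>x. \<bar>x\<bar> \<partial>\<mu> n) - (\<integral>x. \<bar>x\<bar> \<partial>M)) < r"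
    proof (intro exI[of _ N] allI impI)
      fix n assume "n \<ge> N"
      from N[OF this] trunc[OF \<mu>[of n] sq(1) bound(1) K] trunc[OF M sq(2) bound(2) K] BK
      show "norm ((\<integral>x. \<bar>x\<bar> \<partial>\<mu> n) - (\<integral>x. \<bar>x\<bar> \<partial>M)) < r" unfolding real_norm_def by linarith
    qed
  qed
qed

lemma circle_integrable:
  fixes f :: "complex \<Rightarrow> real"
  assumes "f \<in> borel_measurable borel" "\<And>z. cmod z = 1 \<Longrightarrow> \<bar>f z\<bar> \<le> B"
  shows "integrable circle_measure f"
  by (rule circle.integrable_const_bound[where B = B])
     (use assms measurable_circle_borel in \<open>auto intro!: AE_I2\<close>)

lemma circle_mean_Re: "(\<integral>z. Re z \<partial>circle_measure) = 0"
  using circle_integral_rotate[of "-1" Re] by simp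

lemma unit_Re_Im_squared_le:
  assumes "cmod z = 1"
  shows "(Re z)\<^sup>2 \<le> 1" "(Im z)\<^sup>2 \<le> 1"
proof -
  have "(Re z)\<^sup>2 + (Im z)\<^sup>2 = 1" using cmod_power2[of z] assms by simp
  with zero_le_power2[of "Re z"] zero_le_power2[of "Im z"]
  show "(Re z)\<^sup>2 \<le> 1" "(Im z)\<^sup>2 \<le> 1" by linarith+
qed

text \<open>
  The rotation by \<open>\<i>\<close> exchanges the squares of the real and the imaginary part, and these two
  squares add up to \<open>1\<close>.
\<close>

lemma circle_mean_Re_squared: "(\<integral>z. (Re z)\<^sup>2 \<partial>circle_measure) = 1 / 2"
proof -
  have int: "integrable circle_measure (\<lambda>z. (Re z)\<^sup>2)" "integrable circle_measure (\<lambda>z. (Im z)\<^sup>2)"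
    by (rule circle_integrable[where B = 1]; simp add: unit_Re_Im_squared_le)+
  have "(\<integral>z. (Re z)\<^sup>2 \<partial>circle_measure) = (\<integral>z. (Im z)\<^sup>2 \<partial>circle_measure)"
    using circle_integral_rotate[of \<i> "\<lambda>z. (Re z)\<^sup>2"] by simp
  then have "2 * (\<integral>z. (Re z)\<^sup>2 \<partial>circle_measure) = (\<integral>z. (Re z)\<^sup>2 + (Im z)\<^sup>2 \<partial>circle_measure)"
    using int by simp
  also have "\<dots> = (\<integral>z. 1 \<partial>circle_measure)"
    by (intro Bochner_Integration.integral_cong refl) (simp flip: cmod_power2)
  finally show ?thesis by simp
qed

text \<open>
  The central limit theorem needs all variables on one probability space, so the finite tori are
  obtained as marginals of an infinite product.
\<close>

abbreviation circle_process :: "(nat \<Rightarrow> complex) measure" where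
  "circle_process \<equiv> (\<Pi>\<^sub>M n\<in>UNIV. circle_measure)"

lemma process_coordinate_measurable: "(\<lambda>z. z n) \<in> measurable circle_process circle_measure"
  by (rule measurable_component_singleton) simp

lemma process_coordinate_distr: "distr circle_process circle_measure (\<lambda>z. z n) = circle_measure"
  by (rule distr_PiM_component) (auto intro: circle.prob_space_axioms)

lemma process_integral_coordinate:
  fixes f :: "complex \<Rightarrow> real"
  assumes f: "f \<in> borel_measurable borel"
  shows "(\<integral>z. f (z n) \<partial>circle_process) = (\<integral>z. f z \<partial>circle_measure)"
  using integral_distr[OF process_coordinate_measurable measurable_circle_borel[OF f]]
  by (simp add: process_coordinate_distr)

lemma process_integral_restrict:
  fixes f :: "(nat \<Rightarrow> complex) \<Rightarrow> real"
  assumes J: "finite J" and f: "f \<in> borel_measurable (torus J)"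
  shows "(\<integral>z. f (restrict z J) \<partial>circle_process) = (\<integral>z. f z \<partial>torus J)"
proof -
  have "(\<lambda>z. restrict z J) \<in> measurable circle_process (torus J)"
    by (rule measurable_restrict_subset) simp
  from integral_distr[OF this f] show ?thesis
    by (simp add: torus.distr_PiM_restrict_finite[OF J])
qed

lemma process_indep: "prob_space.indep_vars circle_process (\<lambda>_. borel) (\<lambda>n z. Re (z (Suc n))) UNIV"
proof -
  have "prob_space.indep_vars circle_process (\<lambda>_. circle_measure) (\<lambda>n z. z (Suc n)) UNIV"
  proof (subst torus.P.indep_vars_iff_distr_eq_PiM)
    have "distr circle_process (\<Pi>\<^sub>M n\<in>UNIV. circle_measure) (\<lambda>z. \<lambda>n\<in>UNIV. z (Suc n)) = circle_process"
      by (rule distr_PiM_reindex) (auto intro: circle.prob_space_axioms)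
    then show "distr circle_process (\<Pi>\<^sub>M n\<in>UNIV. circle_measure) (\<lambda>z. \<lambda>n\<in>UNIV. z (Suc n)) =
        (\<Pi>\<^sub>M n\<in>UNIV. distr circle_process circle_measure (\<lambda>z. z (Suc n)))"
      by (simp add: process_coordinate_distr)
  qed (auto intro: process_coordinate_measurable)
  then show ?thesis
    by (rule torus.P.indep_vars_compose2) (auto intro: measurable_circle_borel)
qed

text \<open>
  The mixed terms vanish because reflecting one coordinate, \<open>z\<^sub>i \<mapsto> - z\<^sub>i\<close>, preserves the measure.
\<close>

lemma torus_second_moment:
  assumes J: "finite J"
  shows "(\<integral>z. (\<Sum>n\<in>J. Re (z n))\<^sup>2 \<partial>torus J) = card J / 2"
proof -
  interpret T: prob_space "torus J" by (rule prob_space_torus)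
  have meas: "(\<lambda>z. Re (z i) * Re (z j)) \<in> borel_measurable (torus J)" if "i \<in> J" "j \<in> J" for i j
    using torus_coordinate_measurable[OF that(1)] torus_coordinate_measurable[OF that(2)] by measurable
  have int: "integrable (torus J) (\<lambda>z. Re (z i) * Re (z j))" if ij: "i \<in> J" "j \<in> J" for i j
  proof (rule T.integrable_const_bound[OF AE_I2 meas[OF ij], where B = 1])
    fix z assume z: "z \<in> space (torus J)"
    have "\<bar>Re (z i)\<bar> * \<bar>Re (z j)\<bar> \<le> 1 * 1"
      using norm_torus_coordinate[OF z ij(1)] norm_torus_coordinate[OF z ij(2)]
        abs_Re_le_cmod[of "z i"] abs_Re_le_cmod[of "z j"] by (intro mult_mono) auto
    then show "norm (Re (z i) * Re (z j)) \<le> 1" by (simp add: abs_mult)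
  qed
  have off: "(\<integral>z. Re (z i) * Re (z j) \<partial>torus J) = 0" if ij: "i \<in> J" "j \<in> J" "i \<noteq> j" for i j
  proof -
    define w :: "nat \<Rightarrow> complex" where "w n = (if n = i then -1 else 1)" for n
    have "(\<integral>z. Re (z i) * Re (z j) \<partial>torus J) = (\<integral>z. - (Re (z i) * Re (z j)) \<partial>torus J)"
      using torus_integral_rotate[OF J, of w, OF _ meas[OF ij(1,2)]] ij by (simp add: w_def)
    then show ?thesis by simp
  qed
  have diag: "(\<integral>z. Re (z i) * Re (z i) \<partial>torus J) = 1 / 2" if i: "i \<in> J" for i
  proof -
    have "distr (torus J) circle_measure (\<lambda>z. z i) = circle_measure"
      by (rule distr_PiM_component[OF circle.prob_space_axioms i])
    moreover have "(\<lambda>z. (Re z)\<^sup>2) \<in> borel_measurable circle_measure"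
      by (rule measurable_circle_borel) simp
    ultimately show ?thesis
      using integral_distr[OF measurable_component_singleton[OF i, of "\<lambda>_. circle_measure"], of "\<lambda>z. (Re z)\<^sup>2"]
        circle_mean_Re_squared by (simp add: power2_eq_square)
  qed
  have "(\<integral>z. (\<Sum>n\<in>J. Re (z n))\<^sup>2 \<partial>torus J) = (\<Sum>i\<in>J. \<Sum>j\<in>J. \<integral>z. Re (z i) * Re (z j) \<partial>torus J)"
    using int by (simp add: power2_eq_square sum_product Bochner_Integration.integral_sum)
  also have "\<dots> = (\<Sum>i\<in>J. \<Sum>j\<in>J. if i = j then 1 / 2 else 0)"
    by (intro sum.cong refl) (use diag off in auto)
  also have "\<dots> = card J / 2" using J by simp
  finally show ?thesis .
qed

text \<open>
  The normalized sums of the real parts converge to the normal law, whose first absolute moment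
  is \<open>\<surd>(2/\<pi>)\<close>. The factor \<open>\<pi>/2\<close> from the rotation average and the standard deviation \<open>\<surd>(1/2)\<close> of
  one summand turn this into \<open>\<surd>\<pi> / 2\<close>.
\<close>

theorem torus_mean_norm_asymptotics:
  "(\<lambda>x. (\<integral>z. cmod (\<Sum>n\<in>{1..x}. z n) \<partial>torus {1..x}) / sqrt (real x)) \<longlonglongrightarrow> sqrt pi / 2"
proof -
  let ?X = "\<lambda>n z. Re (z (Suc n))"
  let ?T = "\<lambda>n z. (\<Sum>i<n. ?X i z) / sqrt (real n * (sqrt (1/2))\<^sup>2)"
  let ?\<mu> = "\<lambda>n. distr circle_process borel (?T n)"
  have X_meas: "?X n \<in> borel_measurable circle_process" for n
    by (rule measurable_compose[OF process_coordinate_measurable measurable_circle_borel]) simp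
  have T_meas: "?T n \<in> borel_measurable circle_process" for n
    using X_meas by measurable
  have weak: "weak_conv_m ?\<mu> std_normal_distribution"
  proof (rule torus.P.central_limit_theorem_zero_mean)
    show "prob_space.indep_vars circle_process (\<lambda>_. borel) ?X UNIV" by (rule process_indep)
    show mean: "(\<integral>z. ?X n z \<partial>circle_process) = 0" for n
      using process_integral_coordinate[of Re "Suc n"] circle_mean_Re by simp
    show "integrable circle_process (\<lambda>z. (?X n z)\<^sup>2)" for n
    proof -
      have "integrable circle_measure (\<lambda>z. (Re z)\<^sup>2)"
        by (rule circle_integrable[where B = 1]) (simp_all add: unit_Re_Im_squared_le)
      then have "integrable (distr circle_process circle_measure (\<lambda>z. z (Suc n))) (\<lambda>z. (Re z)\<^sup>2)"
        by (simp add: process_coordinate_distr)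
      then show ?thesis
        by (subst (asm) integrable_distr_eq[OF process_coordinate_measurable])
           (auto intro: measurable_circle_borel)
    qed
    show "torus.P.variance (?X n) = (sqrt (1/2))\<^sup>2" for n
      using process_integral_coordinate[of "\<lambda>z. (Re z)\<^sup>2" "Suc n"] circle_mean_Re_squared
      by (simp add: mean)
    show "distr circle_process borel (?X n) = distr circle_measure borel Re" for n
    proof -
      have "distr (distr circle_process circle_measure (\<lambda>z. z (Suc n))) borel Re = distr circle_process borel (Re \<circ> (\<lambda>z. z (Suc n)))"
        by (rule distr_distr[OF measurable_circle_borel process_coordinate_measurable]) simp
      then show ?thesis by (simp add: process_coordinate_distr comp_def)
    qed
  qed simp
  have sum_shift: "(\<Sum>i<n. ?X i z) = (\<Sum>k\<in>{1..n}. Re (restrict z {1..n} k))" for n z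
    by (rule sum.reindex_bij_witness[of _ "\<lambda>k. k - 1" Suc]) auto
  have Re_sum_meas: "(\<lambda>z. \<Sum>k\<in>J. Re (z k)) \<in> borel_measurable (torus J)" for J
    by (intro borel_measurable_sum measurable_compose[OF torus_coordinate_measurable]) auto
  have moment: "(\<integral>x. f x \<partial>?\<mu> n) = (\<integral>z. f ((\<Sum>k\<in>{1..n}. Re (z k)) / sqrt (real n / 2)) \<partial>torus {1..n})"
    if f: "f \<in> borel_measurable borel" for f :: "real \<Rightarrow> real" and n
  proof -
    have "(\<integral>x. f x \<partial>?\<mu> n) = (\<integral>z. f (?T n z) \<partial>circle_process)"
      by (rule integral_distr[OF T_meas f])
    also have "\<dots> = (\<integral>z. f ((\<Sum>k\<in>{1..n}. Re (restrict z {1..n} k)) / sqrt (real n / 2)) \<partial>circle_process)"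
      unfolding sum_shift by simp
    also have "\<dots> = (\<integral>z. f ((\<Sum>k\<in>{1..n}. Re (z k)) / sqrt (real n / 2)) \<partial>torus {1..n})"
      by (rule process_integral_restrict)
         (use measurable_compose[OF borel_measurable_divide[OF Re_sum_meas borel_measurable_const] f] in auto)
    finally show ?thesis .
  qed
  have "(\<lambda>n. \<integral>x. \<bar>x\<bar> \<partial>?\<mu> n) \<longlonglongrightarrow> (\<integral>x. \<bar>x\<bar> \<partial>std_normal_distribution)"
  proof (rule weak_conv_first_moment[OF _ real_dist_normal_dist weak, where B = 1])
    show "real_distribution (?\<mu> n)" for n by (rule torus.P.real_distribution_distr[OF T_meas])
    show "integrable std_normal_distribution (\<lambda>x. x\<^sup>2)" by (rule integrable_std_normal_distribution_moment)
    show "(\<integral>x. x\<^sup>2 \<partial>std_normal_distribution) \<le> 1"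
      using std_normal_distribution_even_moments(1)[of 1] by simp
    show "(\<integral>x. x\<^sup>2 \<partial>?\<mu> n) \<le> 1" for n
    proof -
      have "(\<integral>x. x\<^sup>2 \<partial>?\<mu> n) = (\<integral>z. (\<Sum>k\<in>{1..n}. Re (z k))\<^sup>2 \<partial>torus {1..n}) / (real n / 2)"
        by (subst moment) (simp_all add: power_divide)
      also have "\<dots> \<le> 1" by (subst torus_second_moment) (auto simp: divide_simps)
      finally show ?thesis .
    qed
    show "integrable (?\<mu> n) (\<lambda>x. x\<^sup>2)" for n
    proof (subst integrable_distr_eq[OF T_meas])
      have bound: "\<bar>?T n z\<bar> \<le> real n / sqrt (real n * (sqrt (1/2))\<^sup>2)" if z: "z \<in> space circle_process" for z
      proof -
        have "\<bar>\<Sum>i<n. ?X i z\<bar> \<le> (\<Sum>i<n. 1)"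
        proof (rule sum_norm_le[where 'a = real, simplified])
          fix i
          have "cmod (z (Suc i)) = 1" using z by (auto simp: space_PiM)
          then show "\<bar>Re (z (Suc i))\<bar> \<le> 1" using abs_Re_le_cmod[of "z (Suc i)"] by simp
        qed
        then show ?thesis by (simp add: abs_divide divide_right_mono)
      qed
      show "integrable circle_process (\<lambda>z. (?T n z)\<^sup>2)"
      proof (rule torus.P.integrable_const_bound[OF AE_I2, where B = "(real n / sqrt (real n * (sqrt (1/2))\<^sup>2))\<^sup>2"])
        fix z assume "z \<in> space circle_process"
        from power_mono[OF bound[OF this] abs_ge_zero, of 2]
        show "norm ((?T n z)\<^sup>2) \<le> (real n / sqrt (real n * (sqrt (1/2))\<^sup>2))\<^sup>2"
          by (simp only: power2_abs real_norm_def abs_power2)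
      qed (use T_meas in measurable)
    qed simp
  qed
  moreover have "(\<integral>x. \<bar>x\<bar> \<partial>std_normal_distribution) = sqrt (2 / pi)"
    using std_normal_distribution_odd_moments_abs[of 0] by simp
  moreover have "(\<integral>x. \<bar>x\<bar> \<partial>?\<mu> n) =
      2 * sqrt 2 / pi * ((\<integral>z. cmod (\<Sum>k\<in>{1..n}. z k) \<partial>torus {1..n}) / sqrt (real n))" for n
  proof -
    have "(\<integral>x. \<bar>x\<bar> \<partial>?\<mu> n) = (\<integral>z. \<bar>Re (\<Sum>k\<in>{1..n}. z k)\<bar> \<partial>torus {1..n}) / sqrt (real n / 2)"
      by (subst moment) (simp_all add: abs_divide)
    also have "\<dots> = 2 / pi * (\<integral>z. cmod (\<Sum>k\<in>{1..n}. z k) \<partial>torus {1..n}) / sqrt (real n / 2)"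
      by (subst torus_mean_abs_Re) simp_all
    finally show ?thesis by (simp add: real_sqrt_divide field_simps)
  qed
  ultimately have "(\<lambda>n. 2 * sqrt 2 / pi * ((\<integral>z. cmod (\<Sum>k\<in>{1..n}. z k) \<partial>torus {1..n}) / sqrt (real n)))
      \<longlonglongrightarrow> sqrt (2 / pi)" by simp
  from tendsto_mult_left[OF this, of "pi / (2 * sqrt 2)"]
  have "(\<lambda>n. (\<integral>z. cmod (\<Sum>k\<in>{1..n}. z k) \<partial>torus {1..n}) / sqrt (real n))
      \<longlonglongrightarrow> pi / (2 * sqrt 2) * sqrt (2 / pi)" by simp
  also have "pi / (2 * sqrt 2) * sqrt (2 / pi) = sqrt pi / 2"
    by (simp add: real_sqrt_divide real_div_sqrt)
  finally show ?thesis .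
qed

section \<open>Projections onto isometric copies of \<open>\<ell>\<^sub>1\<close>\<close>

text \<open>
  A Banach space with an isometric copy of \<open>\<ell>\<^sub>1\<close> over the finite index set \<open>J\<close>. The coefficients are
  functions on all natural numbers, whose values off \<open>J\<close> are ignored by \<open>\<Psi>\<close> because of the norm
  formula.
\<close>

locale l1_subspace = complex_banach_space V
  for V :: "('b, 'm) normed_module_scheme" (structure) +
  fixes J :: "nat set" and \<Psi> :: "(nat \<Rightarrow> complex) \<Rightarrow> 'b"
  assumes finite_J: "finite J"
    and \<Psi>_carrier [simp]: "\<Psi> a \<in> carrier V"
    and \<Psi>_add: "\<Psi> (\<lambda>n. a n + b n) = \<Psi> a \<oplus> \<Psi> b"
    and \<Psi>_scale: "\<Psi> (\<lambda>n. c * a n) = c \<odot>\<^bsub>V\<^esub> \<Psi> a"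
    and nrm_\<Psi>: "nrm V (\<Psi> a) = (\<Sum>n\<in>J. cmod (a n))"
begin

lemma \<Psi>_eq_iff: "\<Psi> a = \<Psi> b \<longleftrightarrow> (\<forall>n\<in>J. a n = b n)"
proof -
  have diff: "nrm V (\<Psi> a \<oplus> (-1) \<odot>\<^bsub>V\<^esub> \<Psi> b) = (\<Sum>n\<in>J. cmod (a n - b n))"
    using nrm_\<Psi>[of "\<lambda>n. a n + (-1) * b n"] by (simp only: \<Psi>_add \<Psi>_scale) simp
  have "\<Psi> a = \<Psi> b \<longleftrightarrow> \<Psi> a \<oplus> (-1) \<odot>\<^bsub>V\<^esub> \<Psi> b = \<zero>"
  proof
    assume "\<Psi> a \<oplus> (-1) \<odot>\<^bsub>V\<^esub> \<Psi> b = \<zero>"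
    then have "(\<Psi> b \<oplus> \<Psi> a) \<oplus> (-1) \<odot>\<^bsub>V\<^esub> \<Psi> b = \<Psi> b"
      by (simp add: M.a_assoc)
    then show "\<Psi> a = \<Psi> b" using add_cancel[of "\<Psi> b" "\<Psi> a"] by simp
  qed simp
  also have "\<dots> \<longleftrightarrow> (\<Sum>n\<in>J. cmod (a n - b n)) = 0"
    using diff nrm_eq_0_iff[of "\<Psi> a \<oplus> (-1) \<odot>\<^bsub>V\<^esub> \<Psi> b"] by simp
  also have "\<dots> \<longleftrightarrow> (\<forall>n\<in>J. a n = b n)"
    using finite_J by (subst sum_nonneg_eq_0_iff) auto
  finally show ?thesis .
qed

definition coord :: "'b \<Rightarrow> nat \<Rightarrow> complex" where
  "coord y = inv_into UNIV \<Psi> y"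

lemma \<Psi>_coord: "y \<in> range \<Psi> \<Longrightarrow> \<Psi> (coord y) = y"
  unfolding coord_def by (rule f_inv_into_f[of y \<Psi> UNIV])

lemma coord_\<Psi>: "n \<in> J \<Longrightarrow> coord (\<Psi> a) n = a n"
  using \<Psi>_coord[of "\<Psi> a"] \<Psi>_eq_iff[of "coord (\<Psi> a)" a] by auto

lemma coord_add:
  assumes "x \<in> range \<Psi>" "y \<in> range \<Psi>" "n \<in> J"
  shows "coord (x \<oplus> y) n = coord x n + coord y n"
proof -
  have "x \<oplus> y = \<Psi> (\<lambda>n. coord x n + coord y n)" using assms by (simp add: \<Psi>_add \<Psi>_coord)
  then show ?thesis using coord_\<Psi>[OF assms(3)] by simp
qed

lemma coord_scale:
  assumes "x \<in> range \<Psi>" "n \<in> J"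
  shows "coord (c \<odot>\<^bsub>V\<^esub> x) n = c * coord x n"
proof -
  have "c \<odot>\<^bsub>V\<^esub> x = \<Psi> (\<lambda>n. c * coord x n)" using assms by (simp add: \<Psi>_scale \<Psi>_coord)
  then show ?thesis using coord_\<Psi>[OF assms(2)] by simp
qed

lemma nrm_coord: "x \<in> range \<Psi> \<Longrightarrow> nrm V x = (\<Sum>n\<in>J. cmod (coord x n))"
  using nrm_\<Psi>[of "coord x"] by (simp add: \<Psi>_coord)

lemma range_\<Psi>_subspace:
  "range \<Psi> \<subseteq> carrier V" "\<zero> \<in> range \<Psi>"
  "x \<in> range \<Psi> \<Longrightarrow> y \<in> range \<Psi> \<Longrightarrow> x \<oplus> y \<in> range \<Psi>"
  "x \<in> range \<Psi> \<Longrightarrow> c \<odot>\<^bsub>V\<^esub> x \<in> range \<Psi>"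
proof -
  show "range \<Psi> \<subseteq> carrier V" by auto
  have "\<zero> = \<Psi> (\<lambda>n. 0 * 0)" by (subst \<Psi>_scale) simp
  then show "\<zero> \<in> range \<Psi>" by simp
  show "x \<oplus> y \<in> range \<Psi>" if "x \<in> range \<Psi>" "y \<in> range \<Psi>"
    using that by (auto simp flip: \<Psi>_add)
  show "c \<odot>\<^bsub>V\<^esub> x \<in> range \<Psi>" if "x \<in> range \<Psi>"
    using that by (auto simp flip: \<Psi>_scale)
qed

text \<open>
  On the range of \<open>\<Psi>\<close> the evaluation of \<open>\<Sum> a\<^sub>n z\<^sub>n\<close> at a point \<open>g\<close> of the polydisc is bounded by the
  \<open>\<ell>\<^sub>1\<close>-norm of \<open>a\<close>.
\<close>

lemma extended_evaluation:
  assumes g: "\<And>n. n \<in> J \<Longrightarrow> cmod (g n) \<le> 1"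
  obtains F where
    "\<And>x y. x \<in> carrier V \<Longrightarrow> y \<in> carrier V \<Longrightarrow> F (x \<oplus> y) = F x + F y"
    "\<And>c x. x \<in> carrier V \<Longrightarrow> F (c \<odot>\<^bsub>V\<^esub> x) = c * F x"
    "\<And>x. x \<in> carrier V \<Longrightarrow> cmod (F x) \<le> nrm V x"
    "\<And>a. F (\<Psi> a) = (\<Sum>n\<in>J. a n * g n)"
proof (rule hahn_banach[OF range_\<Psi>_subspace, where f = "\<lambda>x. \<Sum>n\<in>J. coord x n * g n"])
  show "cmod (\<Sum>n\<in>J. coord x n * g n) \<le> nrm V x" if "x \<in> range \<Psi>" for x
    unfolding nrm_coord[OF that] using g
    by (intro sum_norm_le) (simp add: norm_mult mult_left_le)
  show "(\<Sum>n\<in>J. coord (x \<oplus> y) n * g n) = (\<Sum>n\<in>J. coord x n * g n) + (\<Sum>n\<in>J. coord y n * g n)"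
    if "x \<in> range \<Psi>" "y \<in> range \<Psi>" for x y
    by (simp add: coord_add[OF that] distrib_right flip: sum.distrib)
  show "(\<Sum>n\<in>J. coord (c \<odot>\<^bsub>V\<^esub> x) n * g n) = c * (\<Sum>n\<in>J. coord x n * g n)" if "x \<in> range \<Psi>" for c x
    by (simp add: coord_scale[OF that] sum_distrib_left mult.assoc)
next
  fix F :: "'b \<Rightarrow> complex"
  assume F: "\<And>x y. x \<in> carrier V \<Longrightarrow> y \<in> carrier V \<Longrightarrow> F (x \<oplus> y) = F x + F y"
    "\<And>c x. x \<in> carrier V \<Longrightarrow> F (c \<odot>\<^bsub>V\<^esub> x) = c * F x"
    "\<And>x. x \<in> carrier V \<Longrightarrow> cmod (F x) \<le> nrm V x"
    "\<And>x. x \<in> range \<Psi> \<Longrightarrow> F x = (\<Sum>n\<in>J. coord x n * g n)"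
  have "F (\<Psi> a) = (\<Sum>n\<in>J. a n * g n)" for a
    using F(4)[of "\<Psi> a"] coord_\<Psi> by simp
  with F(1-3) show thesis by (rule that)
qed

text \<open>
  This is the orthogonal projection onto the span of the coordinate functions, transported to
  the superspace by the extended evaluations at the grid points. Both the passage from \<open>w\<close> to
  the constant family \<open>1\<close> and the passage from the grid to the torus cost \<open>|J| \<cdot> 2 \<pi> / m\<close>.
\<close>

lemma grid_projection:
  assumes m: "(m::nat) \<ge> 2"
  obtains P where "P \<in> bounded_projections (range \<Psi>) V"
    "\<And>y. y \<in> carrier V \<Longrightarrow>
       nrm V (P y) \<le> ((\<integral>z. cmod (\<Sum>n\<in>J. z n) \<partial>torus J) + 2 * card J * (2 * pi / m)) * nrm V y"
proof -
  let ?C = "(\<integral>z. cmod (\<Sum>n\<in>J. z n) \<partial>torus J) + 2 * card J * (2 * pi / m)"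
  have m0: "m > 0" using m by simp
  have root: "cmod (g n) \<le> 1" if "g \<in> grid J m" "n \<in> J" for g n
    using that norm_unity_root[OF m0, of "g n"] by (auto simp: PiE_iff)
  have "\<forall>g\<in>grid J m. \<exists>F. (\<forall>x\<in>carrier V. \<forall>y\<in>carrier V. F (x \<oplus> y) = F x + F y) \<and>
     (\<forall>c. \<forall>x\<in>carrier V. F (c \<odot>\<^bsub>V\<^esub> x) = c * F x) \<and>
     (\<forall>x\<in>carrier V. cmod (F x) \<le> nrm V x) \<and> (\<forall>a. F (\<Psi> a) = (\<Sum>n\<in>J. a n * g n))"
  proof
    fix g assume g: "g \<in> grid J m"
    from extended_evaluation[of g, OF root[OF g]] obtain F where
      "\<And>x y. x \<in> carrier V \<Longrightarrow> y \<in> carrier V \<Longrightarrow> F (x \<oplus> y) = F x + F y"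
      "\<And>c x. x \<in> carrier V \<Longrightarrow> F (c \<odot>\<^bsub>V\<^esub> x) = c * F x"
      "\<And>x. x \<in> carrier V \<Longrightarrow> cmod (F x) \<le> nrm V x"
      "\<And>a. F (\<Psi> a) = (\<Sum>n\<in>J. a n * g n)" by blast
    then show "\<exists>F. (\<forall>x\<in>carrier V. \<forall>y\<in>carrier V. F (x \<oplus> y) = F x + F y) \<and>
     (\<forall>c. \<forall>x\<in>carrier V. F (c \<odot>\<^bsub>V\<^esub> x) = c * F x) \<and>
     (\<forall>x\<in>carrier V. cmod (F x) \<le> nrm V x) \<and> (\<forall>a. F (\<Psi> a) = (\<Sum>n\<in>J. a n * g n))" by blast
  qed
  then obtain F where
      F_add: "\<And>g x y. g \<in> grid J m \<Longrightarrow> x \<in> carrier V \<Longrightarrow> y \<in> carrier V \<Longrightarrow> F g (x \<oplus> y) = F g x + F g y"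
    and F_scale: "\<And>g c x. g \<in> grid J m \<Longrightarrow> x \<in> carrier V \<Longrightarrow> F g (c \<odot>\<^bsub>V\<^esub> x) = c * F g x"
    and F_le: "\<And>g x. g \<in> grid J m \<Longrightarrow> x \<in> carrier V \<Longrightarrow> cmod (F g x) \<le> nrm V x"
    and F_\<Psi>: "\<And>g a. g \<in> grid J m \<Longrightarrow> F g (\<Psi> a) = (\<Sum>n\<in>J. a n * g n)"
    unfolding bchoice_iff by blast
  define \<phi> where "\<phi> y n = grid_mean J m (\<lambda>g. F g y * cnj (g n))" for y n
  define P where "P y = \<Psi> (\<phi> y)" for y
  have \<phi>_add: "\<phi> (x \<oplus> y) = (\<lambda>n. \<phi> x n + \<phi> y n)" if "x \<in> carrier V" "y \<in> carrier V" for x y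
    unfolding \<phi>_def
    by (intro ext, subst grid_mean_add[symmetric], intro grid_mean_cong)
       (simp add: F_add that distrib_right)
  have \<phi>_scale: "\<phi> (c \<odot>\<^bsub>V\<^esub> x) = (\<lambda>n. c * \<phi> x n)" if "x \<in> carrier V" for c x
    unfolding \<phi>_def
    by (intro ext, subst grid_mean_mult_left[symmetric], intro grid_mean_cong)
       (simp add: F_scale that)
  have bound: "nrm V (P y) \<le> ?C * nrm V y" if y: "y \<in> carrier V" for y
  proof -
    have "\<forall>n. \<exists>c. cmod c = 1 \<and> c * \<phi> y n = cmod (\<phi> y n)"
      using unimodular_rotation by metis
    then obtain w where w: "\<And>n. cmod (w n) = 1" "\<And>n. w n * \<phi> y n = cmod (\<phi> y n)" by metis
    \<comment> \<open>The norm of \<open>P y\<close> is the \<open>\<ell>\<^sub>1\<close>-norm of \<open>\<phi> y\<close>; rotating the coordinates by \<open>w\<close> writes it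
      as a single linear expression in \<open>\<phi> y\<close>.\<close>
    let ?S = "\<lambda>g. \<Sum>n\<in>J. w n * g n" and ?S' = "\<lambda>g. \<Sum>n\<in>J. w n * cnj (g n)"
    have "complex_of_real (nrm V (P y)) = (\<Sum>n\<in>J. w n * \<phi> y n)"
      by (simp add: P_def nrm_\<Psi> w(2))
    also have "\<dots> = (\<Sum>n\<in>J. grid_mean J m (\<lambda>g. w n * (F g y * cnj (g n))))"
      by (simp add: \<phi>_def grid_mean_mult_left)
    also have "\<dots> = grid_mean J m (\<lambda>g. \<Sum>n\<in>J. w n * (F g y * cnj (g n)))"
      by (rule grid_mean_sum[symmetric])
    also have "\<dots> = grid_mean J m (\<lambda>g. F g y * ?S' g)"
      by (intro grid_mean_cong) (simp add: sum_distrib_left mult_ac)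
    finally have eq: "complex_of_real (nrm V (P y)) = grid_mean J m (\<lambda>g. F g y * ?S' g)" .
    have "nrm V (P y) = cmod (complex_of_real (nrm V (P y)))"
      using nrm_nonneg[of "P y"] by (simp add: P_def)
    also have "\<dots> \<le> grid_mean J m (\<lambda>g. cmod (F g y * ?S' g))"
      unfolding eq by (rule norm_grid_mean)
    also have "\<dots> \<le> grid_mean J m (\<lambda>g. nrm V y * cmod (?S' g))"
      by (intro grid_mean_mono) (simp add: norm_mult F_le y mult_right_mono)
    also have "\<dots> = nrm V y * grid_mean J m (\<lambda>g. cmod (?S' g))" by (rule grid_mean_mult_left)
    also have "\<dots> \<le> nrm V y * ?C"
    proof (rule mult_left_mono[OF _ nrm_nonneg[OF y]])
      have "grid_mean J m (\<lambda>g. cmod (?S' g)) = grid_mean J m (\<lambda>g. cmod (?S (\<lambda>n\<in>J. 1 * cnj (g n))))"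
        by (intro grid_mean_cong arg_cong[where f = cmod]) simp
      also have "\<dots> = grid_mean J m (\<lambda>g. cmod (?S g))"
        by (rule grid_mean_reflect[OF m0]) simp
      also have "\<dots> \<le> ?C"
      proof -
        have "2 * card J * (2 * pi / m) = 2 * (card J * (2 * pi / m))" by simp
        with grid_mean_rotation_close[of J m w, OF finite_J m0 w(1)] grid_mean_torus_close[OF finite_J m0]
        show ?thesis by linarith
      qed
      finally show "grid_mean J m (\<lambda>g. cmod (?S' g)) \<le> ?C" .
    qed
    finally show ?thesis by (simp only: mult.commute)
  qed
  have "P (\<Psi> a) = \<Psi> a" for a
    unfolding P_def \<Psi>_eq_iff
  proof
    fix n assume n: "n \<in> J"
    have "\<phi> (\<Psi> a) n = grid_mean J m (\<lambda>g. \<Sum>k\<in>J. a k * (g k * cnj (g n)))"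
      unfolding \<phi>_def by (intro grid_mean_cong) (simp add: F_\<Psi> sum_distrib_right mult.assoc)
    also have "\<dots> = (\<Sum>k\<in>J. if k = n then a k else 0)"
      unfolding grid_mean_sum grid_mean_mult_left
      by (intro sum.cong refl) (simp add: grid_mean_orthogonal[OF finite_J m _ n])
    also have "\<dots> = a n" using n finite_J by simp
    finally show "\<phi> (\<Psi> a) n = a n" .
  qed
  then have "P \<in> bounded_projections (range \<Psi>) V"
    using bound unfolding bounded_projections_def bounded_linear_maps_def linear_maps_def
    by (auto simp: P_def \<phi>_add \<phi>_scale \<Psi>_add \<Psi>_scale)
  with bound show thesis by (intro that)
qed

lemma rel_proj_const_le:
  "rel_proj_const (range \<Psi>) V \<le> ennreal (\<integral>z. cmod (\<Sum>n\<in>J. z n) \<partial>torus J)"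
proof (rule ennreal_le_epsilon)
  let ?C = "\<integral>z. cmod (\<Sum>n\<in>J. z n) \<partial>torus J"
  fix e :: real assume e: "e > 0"
  have "(\<lambda>m. 2 * card J * (2 * pi) / real m) \<longlonglongrightarrow> 0" by (rule lim_const_over_n)
  from eventually_conj[OF order_tendstoD(2)[OF this e] eventually_ge_at_top[of 2]]
  obtain m :: nat where m: "m \<ge> 2" "2 * card J * (2 * pi / m) < e"
    by (auto simp: eventually_sequentially)
  obtain P where P: "P \<in> bounded_projections (range \<Psi>) V"
    "\<And>y. y \<in> carrier V \<Longrightarrow> nrm V (P y) \<le> (?C + 2 * card J * (2 * pi / m)) * nrm V y"
    using grid_projection[OF m(1)] by blast
  have C: "?C \<ge> 0" by simp
  have "rel_proj_const (range \<Psi>) V \<le> op_norm V V P"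
    unfolding rel_proj_const_def by (rule INF_lower[OF P(1)])
  also have "\<dots> \<le> ennreal (?C + e)"
    unfolding op_norm_def
  proof (rule SUP_least, rule ennreal_leI)
    fix y assume y: "y \<in> {x \<in> carrier V. nrm V x \<le> 1}"
    have "nrm V (P y) \<le> (?C + 2 * card J * (2 * pi / m)) * 1"
      using P(2)[of y] y C by (intro order_trans[OF P(2)] mult_left_mono) auto
    then show "nrm V (P y) \<le> ?C + e" using m(2) by simp
  qed
  also have "\<dots> = ennreal ?C + ennreal e" using C e by simp
  finally show "rel_proj_const (range \<Psi>) V \<le> ennreal ?C + ennreal e" .
qed

end

section \<open>The space of bounded functions\<close>

text \<open>
  The space \<open>\<ell>\<^sub>\<infinity>\<close> over a set of points \<open>'c\<close>, carried by the left summand of the universe over which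
  projection constants are formed.
\<close>

definition bounded_functions :: "(('c \<Rightarrow> complex) + 'y) normed_module" where
  "bounded_functions = \<lparr>
     carrier = Inl ` {f. bounded (range f)},
     monoid.mult = undefined, one = undefined,
     zero = Inl (\<lambda>s. 0), add = (\<lambda>x y. Inl (\<lambda>s. projl x s + projl y s)),
     smult = (\<lambda>c x. Inl (\<lambda>s. c * projl x s)),
     nrm = (\<lambda>x. SUP s. cmod (projl x s)) \<rparr>"

lemma bounded_functions_simps [simp]:
  "x \<oplus>\<^bsub>bounded_functions\<^esub> y = Inl (\<lambda>s. projl x s + projl y s)"
  "\<zero>\<^bsub>bounded_functions\<^esub> = Inl (\<lambda>s. 0)"
  "c \<odot>\<^bsub>bounded_functions\<^esub> x = Inl (\<lambda>s. c * projl x s)"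
  "nrm bounded_functions x = (SUP s. cmod (projl x s))"
  by (simp_all add: bounded_functions_def)

lemma bounded_functions_carrier:
  "x \<in> carrier bounded_functions \<longleftrightarrow> (\<exists>f. x = Inl f \<and> bounded (range f))"
  by (auto simp: bounded_functions_def)

lemma Inl_in_bounded_functions [simp]:
  "Inl f \<in> carrier bounded_functions \<longleftrightarrow> bounded (range f)"
  by (auto simp: bounded_functions_carrier)

lemma bounded_rangeI: "(\<And>s. cmod (f s) \<le> B) \<Longrightarrow> bounded (range f)"
  by (auto simp: bounded_iff)

lemma bounded_cmult:
  fixes f :: "'c \<Rightarrow> complex"
  assumes "bounded (range f)"
  shows "bounded (range (\<lambda>s. c * f s))"
proof -
  obtain B where "\<And>s. cmod (f s) \<le> B" using assms by (auto simp: bounded_iff)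
  then show ?thesis
    by (intro bounded_rangeI[where B = "cmod c * B"]) (simp add: norm_mult mult_left_mono)
qed

lemma bdd_above_norm: "bounded (range f) \<Longrightarrow> bdd_above (range (\<lambda>s. cmod (f s)))"
  by (auto simp: bounded_iff bdd_above_def)

lemma norm_le_SUP: "bounded (range f) \<Longrightarrow> cmod (f s) \<le> (SUP s. cmod (f s))"
  by (rule cSUP_upper[OF UNIV_I bdd_above_norm])

lemma module_bounded_functions:
  "Module.module (ring_of_type_algebra :: complex ring) (bounded_functions :: (('c \<Rightarrow> complex) + 'y) normed_module)"
    (is "Module.module _ ?Y")
proof (rule moduleI)
  show "cring (ring_of_type_algebra :: complex ring)" by (rule cring_from_type_algebra)
  show "abelian_group ?Y"
  proof (rule abelian_groupI)
    fix x assume "x \<in> carrier ?Y"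
    then obtain f where x: "x = Inl f" "bounded (range f)" by (auto simp: bounded_functions_carrier)
    then have "Inl (\<lambda>s. - f s) \<in> carrier ?Y" by (auto simp: bounded_iff)
    with x show "\<exists>y\<in>carrier ?Y. y \<oplus>\<^bsub>?Y\<^esub> x = \<zero>\<^bsub>?Y\<^esub>" by (intro bexI[of _ "Inl (\<lambda>s. - f s)"]) auto
  qed (auto simp: bounded_functions_carrier algebra_simps intro: bounded_plus_comp)
qed (auto simp: bounded_functions_carrier ring_of_type_algebra_def algebra_simps intro: bounded_plus_comp
       intro!: bounded_cmult)


lemma complex_banach_space_bounded_functions:
  "complex_banach_space (bounded_functions :: (('c \<Rightarrow> complex) + 'y) normed_module)"
    (is "complex_banach_space ?Y")
proof -
  interpret Module.module "ring_of_type_algebra :: complex ring" ?Y by (rule module_bounded_functions)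
  have minus: "Inl f \<ominus>\<^bsub>?Y\<^esub> Inl g = Inl (\<lambda>s. f s - g s)" if "bounded (range g)" for f g :: "'c \<Rightarrow> complex"
  proof -
    have "\<ominus>\<^bsub>?Y\<^esub> Inl g = Inl (\<lambda>s. - g s)"
      by (rule M.minus_equality) (use that in \<open>auto simp: bounded_iff\<close>)
    then show ?thesis by (simp add: a_minus_def)
  qed
  show ?thesis
  proof
    fix x y :: "('c \<Rightarrow> complex) + 'y" and c :: complex
    assume "x \<in> carrier ?Y"
    then obtain f where x: "x = Inl f" and f: "bounded (range f)" by (auto simp: bounded_functions_carrier)
    note le = norm_le_SUP[OF f]
    show nonneg: "0 \<le> nrm ?Y x" using order_trans[OF norm_ge_zero le[of undefined]] x by simp
    show "nrm ?Y x = 0 \<longleftrightarrow> x = \<zero>\<^bsub>?Y\<^esub>"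
    proof
      assume "nrm ?Y x = 0"
      then have "cmod (f s) \<le> 0" for s using le[of s] x by simp
      then show "x = \<zero>\<^bsub>?Y\<^esub>" using x by auto
    qed simp
    show "nrm ?Y (c \<odot>\<^bsub>?Y\<^esub> x) = cmod c * nrm ?Y x"
    proof -
      have "(SUP s. cmod c * cmod (f s)) = cmod c * (SUP s. cmod (f s))"
        using bdd_above_norm[OF f] continuous_at_Sup_mono[of "\<lambda>r. cmod c * r" "range (\<lambda>s. cmod (f s))"]
        by (simp add: image_image mono_def mult_left_mono continuous_intros)
      then show ?thesis using x by (simp add: norm_mult)
    qed
    assume "y \<in> carrier ?Y"
    then obtain g where y: "y = Inl g" and g: "bounded (range g)" by (auto simp: bounded_functions_carrier)
    have "(SUP s. cmod (f s + g s)) \<le> (SUP s. cmod (f s)) + (SUP s. cmod (g s))"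
      by (rule cSUP_least) (auto intro: order_trans[OF norm_triangle_ineq add_mono[OF le norm_le_SUP[OF g]]])
    then show "nrm ?Y (x \<oplus>\<^bsub>?Y\<^esub> y) \<le> nrm ?Y x + nrm ?Y y" using x y by simp
  next
    fix \<sigma> :: "nat \<Rightarrow> ('c \<Rightarrow> complex) + 'y"
    assume carr: "\<forall>n. \<sigma> n \<in> carrier ?Y"
      and cauchy: "\<forall>\<epsilon>>0. \<exists>N. \<forall>m\<ge>N. \<forall>n\<ge>N. nrm ?Y (\<sigma> m \<ominus>\<^bsub>?Y\<^esub> \<sigma> n) < \<epsilon>"
    define f where "f n = projl (\<sigma> n)" for n
    have \<sigma>: "\<sigma> n = Inl (f n)" and bdd: "bounded (range (f n))" for n
      using carr[rule_format, of n] by (auto simp: bounded_functions_carrier f_def)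
    have diff_bdd: "bounded (range (\<lambda>s. f m s - g s))" if "bounded (range g)" for m g
      by (rule bounded_minus_comp[OF bdd that])
    have "uniformly_Cauchy_on UNIV f"
      unfolding uniformly_Cauchy_on_def
    proof (intro allI impI)
      fix e :: real assume "e > 0"
      with cauchy obtain N where N: "\<And>m n. m \<ge> N \<Longrightarrow> n \<ge> N \<Longrightarrow> nrm ?Y (\<sigma> m \<ominus>\<^bsub>?Y\<^esub> \<sigma> n) < e" by blast
      have "dist (f m s) (f n s) < e" if "m \<ge> N" "n \<ge> N" for m n s
      proof -
        have "dist (f m s) (f n s) \<le> nrm ?Y (\<sigma> m \<ominus>\<^bsub>?Y\<^esub> \<sigma> n)"
          using norm_le_SUP[OF diff_bdd[OF bdd[of n], of m], of s] by (simp add: \<sigma> minus[OF bdd] dist_norm)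
        with N[OF that] show ?thesis by simp
      qed
      then show "\<exists>M. \<forall>x\<in>UNIV. \<forall>m\<ge>M. \<forall>n\<ge>M. dist (f m x) (f n x) < e" by blast
    qed
    then obtain l where l: "uniform_limit UNIV f l sequentially"
      using Cauchy_uniformly_convergent uniformly_convergent_on_def by blast
    have close: "\<exists>N. \<forall>n\<ge>N. \<forall>s. cmod (f n s - l s) \<le> e" if "e > 0" for e
    proof -
      obtain N where "\<And>n s. n \<ge> N \<Longrightarrow> dist (f n s) (l s) < e"
        using uniform_limitD[OF l \<open>e > 0\<close>] by (auto simp: eventually_sequentially)
      then show ?thesis by (intro exI[of _ N]) (auto simp: dist_norm intro: less_imp_le)
    qed
    have l_bdd: "bounded (range l)"
    proof -
      obtain n where n: "\<forall>s. cmod (f n s - l s) \<le> 1" using close[of 1] by auto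
      then have "bounded (range (\<lambda>s. f n s - l s))" by (intro bounded_rangeI) auto
      from bounded_minus_comp[OF bdd[of n] this] show ?thesis by simp
    qed
    show "\<exists>x\<in>carrier ?Y. (\<lambda>n. nrm ?Y (\<sigma> n \<ominus>\<^bsub>?Y\<^esub> x)) \<longlonglongrightarrow> 0"
    proof (intro bexI[of _ "Inl l"] LIMSEQ_I)
      fix e :: real assume e: "e > 0"
      from close[of "e / 2"] e obtain N where N: "\<And>n s. n \<ge> N \<Longrightarrow> cmod (f n s - l s) \<le> e / 2" by auto
      have "norm (nrm ?Y (\<sigma> n \<ominus>\<^bsub>?Y\<^esub> Inl l) - 0) < e" if n: "n \<ge> N" for n
      proof -
        have "(SUP s. cmod (f n s - l s)) \<le> e / 2" by (rule cSUP_least) (use N[OF n] in auto)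
        moreover have "0 \<le> (SUP s. cmod (f n s - l s))"
          using order_trans[OF norm_ge_zero norm_le_SUP[OF diff_bdd[OF l_bdd, of n], of undefined]] .
        ultimately show ?thesis using e by (simp add: \<sigma> minus[OF l_bdd])
      qed
      then show "\<exists>N. \<forall>n\<ge>N. norm (nrm ?Y (\<sigma> n \<ominus>\<^bsub>?Y\<^esub> Inl l) - 0) < e" by blast
    qed (simp add: l_bdd)
  qed
qed

text \<open>
  Boundedness of the sum is proved along with its linearity, because the induction needs it.
\<close>

lemma linear_sum_bounded_functions:
  fixes Y :: "(('c \<Rightarrow> complex) + 'y) normed_module" and \<phi> :: "('c \<Rightarrow> complex) + 'y \<Rightarrow> complex"
  assumes Y: "Y = bounded_functions"
    and add: "\<And>x y. x \<in> carrier Y \<Longrightarrow> y \<in> carrier Y \<Longrightarrow> \<phi> (x \<oplus>\<^bsub>Y\<^esub> y) = \<phi> x + \<phi> y"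
    and scale: "\<And>c x. x \<in> carrier Y \<Longrightarrow> \<phi> (c \<odot>\<^bsub>Y\<^esub> x) = c * \<phi> x"
    and fin: "finite A" and h: "\<And>i. i \<in> A \<Longrightarrow> bounded (range (h i))"
  shows "\<phi> (Inl (\<lambda>s. \<Sum>i\<in>A. h i s)) = (\<Sum>i\<in>A. \<phi> (Inl (h i))) \<and>
    bounded (range (\<lambda>s. \<Sum>i\<in>A. h i s))"
  using fin h
proof (induction A)
  case empty
  show ?case using scale[of "Inl (\<lambda>s. 0)" 0] by (simp add: Y)
next
  case (insert j A)
  then have bdd: "bounded (range (h j))" "bounded (range (\<lambda>s. \<Sum>i\<in>A. h i s))" by auto
  show ?case
    using add[of "Inl (h j)" "Inl (\<lambda>s. \<Sum>i\<in>A. h i s)"] bdd bounded_plus_comp[OF bdd] insert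
    by (simp add: Y)
qed

text \<open>
  Unimodular functions \<open>e n\<close> on a set of points that are isometrically equivalent to the unit
  vectors of \<open>\<ell>\<^sub>1\<close>. The map \<open>s \<mapsto> e s\<close> sends the points to the torus, along which functions on the
  torus are pulled back.
\<close>

locale unimodular_l1_system =
  fixes J :: "nat set" and e :: "'c \<Rightarrow> nat \<Rightarrow> complex"
  assumes finite_J: "finite J"
    and norm_e: "n \<in> J \<Longrightarrow> cmod (e s n) = 1"
    and SUP_eq: "(SUP s. cmod (\<Sum>n\<in>J. a n * e s n)) = (\<Sum>n\<in>J. cmod (a n))"
begin

definition \<Psi> :: "(nat \<Rightarrow> complex) \<Rightarrow> ('c \<Rightarrow> complex) + 'y" where
  "\<Psi> a = Inl (\<lambda>s. \<Sum>n\<in>J. a n * e s n)"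

lemma bounded_combination: "bounded (range (\<lambda>s. \<Sum>n\<in>J. a n * e s n))"
  by (rule bounded_rangeI[where B = "\<Sum>n\<in>J. cmod (a n)"], rule sum_norm_le)
     (simp add: norm_mult norm_e)

lemma l1_subspace_\<Psi>: "l1_subspace (bounded_functions :: (('c \<Rightarrow> complex) + 'y) normed_module) J \<Psi>"
proof (rule l1_subspace.intro[OF complex_banach_space_bounded_functions], unfold_locales)
  show "finite J" by (rule finite_J)
qed (simp_all add: \<Psi>_def bounded_combination SUP_eq distrib_right sum.distrib sum_distrib_left mult.assoc)

text \<open>
  For a function \<open>f\<close> on the torus put \<open>f\<^sub>w z = f (z cnj w)\<close>. The mean over \<open>w\<close> of \<open>w\<^sub>k f\<^sub>w z\<close> is
  \<open>z\<^sub>k\<close> times the \<open>k\<close>-th Fourier coefficient of \<open>f\<close>, so a projection, being the identity on the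
  coordinates, has no influence on the mean of \<open>\<Sum> w\<^sub>k \<phi>\<^sub>k(f\<^sub>w)\<close>: it is the sum of these Fourier
  coefficients, which for \<open>f = sgn (\<Sum> z\<^sub>n)\<close> is the mean of \<open>|\<Sum> z\<^sub>n|\<close>. Since only grid points are
  available for \<open>w\<close>, the argument of \<open>f\<close> is first rounded to the grid.
\<close>

theorem op_norm_ge:
  fixes P :: "('c \<Rightarrow> complex) + 'y \<Rightarrow> ('c \<Rightarrow> complex) + 'y"
  assumes P: "P \<in> bounded_projections (range \<Psi>) bounded_functions"
  shows "ennreal (\<integral>z. cmod (\<Sum>n\<in>J. z n) \<partial>torus J) \<le> op_norm bounded_functions bounded_functions P"
proof -
  let ?Y = "bounded_functions :: (('c \<Rightarrow> complex) + 'y) normed_module"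
  interpret l1_subspace ?Y J "\<Psi> :: _ \<Rightarrow> ('c \<Rightarrow> complex) + 'y" by (rule l1_subspace_\<Psi>)
  let ?C = "\<integral>z. cmod (\<Sum>n\<in>J. z n) \<partial>torus J"
  have P_add: "P (x \<oplus>\<^bsub>?Y\<^esub> y) = P x \<oplus>\<^bsub>?Y\<^esub> P y" if "x \<in> carrier ?Y" "y \<in> carrier ?Y" for x y
    using P that unfolding bounded_projections_def bounded_linear_maps_def linear_maps_def by blast
  have P_scale: "P (c \<odot>\<^bsub>?Y\<^esub> x) = c \<odot>\<^bsub>?Y\<^esub> P x" if "x \<in> carrier ?Y" for c x
    using P that unfolding bounded_projections_def bounded_linear_maps_def linear_maps_def by blast
  have P_range: "P x \<in> range \<Psi>" if "x \<in> carrier ?Y" for x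
    using P that unfolding bounded_projections_def by blast
  have P_\<Psi>: "P (\<Psi> a) = \<Psi> a" for a
    using P unfolding bounded_projections_def by blast
  obtain K0 where K0: "\<And>x. x \<in> carrier ?Y \<Longrightarrow> nrm ?Y (P x) \<le> K0 * nrm ?Y x"
    using P unfolding bounded_projections_def bounded_linear_maps_def by blast
  define K where "K = \<bar>K0\<bar>"
  have K: "nrm ?Y (P x) \<le> K * nrm ?Y x" if "x \<in> carrier ?Y" for x
    using K0[OF that] mult_right_mono[OF abs_ge_self[of K0] nrm_nonneg[OF that]] unfolding K_def by linarith
  define \<phi> where "\<phi> k x = coord (P x) k" for k x
  have \<phi>_add: "\<phi> k (x \<oplus>\<^bsub>?Y\<^esub> y) = \<phi> k x + \<phi> k y" if "x \<in> carrier ?Y" "y \<in> carrier ?Y" "k \<in> J" for k x y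
    unfolding \<phi>_def P_add[OF that(1,2)] by (rule coord_add[OF P_range[OF that(1)] P_range[OF that(2)] that(3)])
  have \<phi>_scale: "\<phi> k (c \<odot>\<^bsub>?Y\<^esub> x) = c * \<phi> k x" if "x \<in> carrier ?Y" "k \<in> J" for k c x
    unfolding \<phi>_def P_scale[OF that(1)] by (rule coord_scale[OF P_range[OF that(1)] that(2)])
  have \<phi>_\<Psi>: "\<phi> k (\<Psi> a) = a k" if "k \<in> J" for k a
    unfolding \<phi>_def P_\<Psi> by (rule coord_\<Psi>[OF that])
  have nrm_P: "nrm ?Y (P x) = (\<Sum>k\<in>J. cmod (\<phi> k x))" if "x \<in> carrier ?Y" for x
    unfolding \<phi>_def by (rule nrm_coord[OF P_range[OF that]])
  have \<phi>_le: "cmod (\<phi> k x) \<le> K * nrm ?Y x" if x: "x \<in> carrier ?Y" and k: "k \<in> J" for k x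
  proof -
    have "cmod (\<phi> k x) \<le> (\<Sum>k\<in>J. cmod (\<phi> k x))"
      using k finite_J by (intro member_le_sum) auto
    then show ?thesis using K[OF x] nrm_P[OF x] by linarith
  qed
  show ?thesis
  proof (cases "op_norm ?Y ?Y P")
    case (real b)
    have b: "nrm ?Y (P x) \<le> b" if "x \<in> carrier ?Y" "nrm ?Y x \<le> 1" for x
    proof -
      have "ennreal (nrm ?Y (P x)) \<le> op_norm ?Y ?Y P"
        unfolding op_norm_def using that by (intro SUP_upper) auto
      then show ?thesis using real by (simp add: ennreal_le_iff)
    qed
    have main: "?C \<le> b + card J * (1 + K) * (2 * pi) / real m" if m: "m > 0" for m :: nat
    proof -
      have "\<forall>z. \<exists>r. cmod z = 1 \<longrightarrow> r \<in> unity_roots m \<and> cmod (z - r) \<le> 2 * pi / m"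
        using unity_root_near[OF _ m] by metis
      then obtain \<rho> where \<rho>: "\<And>z. cmod z = 1 \<Longrightarrow> \<rho> z \<in> unity_roots m"
        "\<And>z. cmod z = 1 \<Longrightarrow> cmod (z - \<rho> z) \<le> 2 * pi / m" by metis
      define R where "R s n = \<rho> (e s n)" for s n
      have R_root: "R s n \<in> unity_roots m" if "n \<in> J" for s n
        unfolding R_def by (rule \<rho>(1)[OF norm_e[OF that]])
      have R_norm: "cmod (R s n) = 1" if "n \<in> J" for s n
        by (rule norm_unity_root[OF m R_root[OF that]])
      have R_bdd: "bounded (range (\<lambda>s. R s k))" if "k \<in> J" for k
        by (rule bounded_rangeI[where B = 1]) (simp add: R_norm[OF that])
      have root: "cmod (g n) = 1" if "g \<in> grid J m" "n \<in> J" for g n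
        using that norm_unity_root[OF m, of "g n"] by (auto simp: PiE_iff)
      define f where "f v = sgn (\<Sum>n\<in>J. v n)" for v :: "nat \<Rightarrow> complex"
      have f_norm: "cmod (f v) \<le> 1" for v by (simp add: f_def norm_sgn)
      \<comment> \<open>The Fourier coefficients of \<open>f\<close> on the grid.\<close>
      define c where "c k = grid_mean J m (\<lambda>v. cnj (v k) * f v)" for k
      have c_norm: "cmod (c k) \<le> 1" if "k \<in> J" for k
      proof -
        have "cmod (c k) \<le> grid_mean J m (\<lambda>v. cmod (cnj (v k) * f v))"
          unfolding c_def by (rule norm_grid_mean)
        also have "\<dots> \<le> grid_mean J m (\<lambda>v. 1)"
          by (intro grid_mean_mono) (simp add: norm_mult root that f_norm)
        also have "\<dots> = 1" by (rule grid_mean_const[OF finite_J m])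
        finally show ?thesis .
      qed
      have sum_c: "(\<Sum>k\<in>J. c k) = complex_of_real (grid_mean J m (\<lambda>g. cmod (\<Sum>n\<in>J. g n)))"
      proof -
        have "cnj z * sgn z = complex_of_real (cmod z)" for z
          using complex_norm_square[of z]
          by (cases "z = 0") (simp_all add: sgn_eq field_simps power2_eq_square)
        note sgn = this
        have "(\<Sum>k\<in>J. c k) = grid_mean J m (\<lambda>v. cnj (\<Sum>k\<in>J. v k) * f v)"
          by (simp add: c_def grid_mean_sum[symmetric] sum_distrib_right)
        also have "\<dots> = grid_mean J m (\<lambda>v. complex_of_real (cmod (\<Sum>k\<in>J. v k)))"
          unfolding f_def sgn ..
        finally show ?thesis by (simp add: grid_mean_of_real)
      qed
      \<comment> \<open>The test functions: the translates of \<open>f\<close> by grid points, pulled back along the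
        rounded map \<open>R\<close>.\<close>
      define h where "h w s = f (\<lambda>n\<in>J. R s n * cnj (w n))" for w s
      have h_bdd: "bounded (range (h w))" for w
        by (rule bounded_rangeI[where B = 1]) (simp add: h_def f_norm)
      have h_nrm: "nrm ?Y (Inl (h w)) \<le> 1" for w
        by (simp, rule cSUP_least) (simp_all add: h_def f_norm)
      have avg: "grid_mean J m (\<lambda>w. w k * \<phi> k (Inl (h w))) = c k * \<phi> k (Inl (\<lambda>s. R s k))" if k: "k \<in> J" for k
      proof -
        let ?G = "grid J m" and ?d = "complex_of_real (inverse (card (grid J m)))"
        have pt: "?d * (\<Sum>w\<in>?G. w k * h w s) = c k * R s k" for s
        proof -
          have "?d * (\<Sum>w\<in>?G. w k * h w s) = grid_mean J m (\<lambda>w. w k * h w s)"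
            by (simp add: grid_mean_def scaleR_conv_of_real)
          also have "\<dots> = grid_mean J m (\<lambda>w. (\<lambda>v. R s k * (cnj (v k) * f v)) (\<lambda>n\<in>J. R s n * cnj (w n)))"
          proof (rule grid_mean_cong)
            fix w assume "w \<in> ?G"
            have "R s k * cnj (R s k) = 1" by (rule cnj_mult_unity_root(2)[OF m R_root[OF k]])
            then show "w k * h w s = (\<lambda>v. R s k * (cnj (v k) * f v)) (\<lambda>n\<in>J. R s n * cnj (w n))"
              using k by (simp add: h_def)
          qed
          also have "\<dots> = grid_mean J m (\<lambda>v. R s k * (cnj (v k) * f v))"
            by (rule grid_mean_reflect[OF m R_root])
          also have "\<dots> = c k * R s k" by (simp add: grid_mean_mult_left c_def mult.commute)
          finally show ?thesis .
        qed
        have "grid_mean J m (\<lambda>w. w k * \<phi> k (Inl (h w))) = ?d * (\<Sum>w\<in>?G. \<phi> k (Inl (\<lambda>s. w k * h w s)))"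
          using \<phi>_scale[OF _ k, of "Inl (h _)"] h_bdd
          by (simp add: grid_mean_def scaleR_conv_of_real)
        also have "(\<Sum>w\<in>?G. \<phi> k (Inl (\<lambda>s. w k * h w s))) = \<phi> k (Inl (\<lambda>s. \<Sum>w\<in>?G. w k * h w s))"
          using linear_sum_bounded_functions[OF refl \<phi>_add[OF _ _ k] \<phi>_scale[OF _ k] finite_grid[OF finite_J m],
              of "\<lambda>w s. w k * h w s"] bounded_cmult[OF h_bdd] by simp
        also have "?d * \<dots> = \<phi> k (Inl (\<lambda>s. ?d * (\<Sum>w\<in>?G. w k * h w s)))"
          using linear_sum_bounded_functions[OF refl \<phi>_add[OF _ _ k] \<phi>_scale[OF _ k] finite_grid[OF finite_J m],
              of "\<lambda>w s. w k * h w s"] bounded_cmult[OF h_bdd]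
            \<phi>_scale[OF _ k, of "Inl (\<lambda>s. \<Sum>w\<in>?G. w k * h w s)" ?d] by simp
        also have "\<dots> = \<phi> k (Inl (\<lambda>s. c k * R s k))" unfolding pt ..
        also have "\<dots> = c k * \<phi> k (Inl (\<lambda>s. R s k))"
          using \<phi>_scale[OF _ k, of "Inl (\<lambda>s. R s k)" "c k"] R_bdd[OF k] by simp
        finally show ?thesis .
      qed
      \<comment> \<open>The rounding is uniformly close to the coordinate function, which the projection fixes.\<close>
      have near: "cmod (\<phi> k (Inl (\<lambda>s. R s k)) - 1) \<le> K * (2 * pi / m)" if k: "k \<in> J" for k
      proof -
        define \<delta> where "\<delta> n = (if n = k then 1 else 0 :: complex)" for n
        have \<Psi>\<delta>: "\<Psi> \<delta> = Inl (\<lambda>s. e s k)"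
          unfolding \<Psi>_def \<delta>_def using k finite_J by (simp add: if_distrib[of "\<lambda>x. x * _"] cong: if_cong)
        have D: "bounded (range (\<lambda>s. R s k - e s k))"
        proof (rule bounded_minus_comp[OF R_bdd[OF k]])
          show "bounded (range (\<lambda>s. e s k))" by (rule bounded_rangeI[where B = 1]) (simp add: norm_e[OF k])
        qed
        have "\<phi> k (Inl (\<lambda>s. R s k)) = \<phi> k (\<Psi> \<delta>) + \<phi> k (Inl (\<lambda>s. R s k - e s k))"
          using \<phi>_add[of "\<Psi> \<delta>" "Inl (\<lambda>s. R s k - e s k)", OF _ _ k] D \<Psi>_carrier[of \<delta>] by (simp add: \<Psi>\<delta>)
        then have "\<phi> k (Inl (\<lambda>s. R s k)) - 1 = \<phi> k (Inl (\<lambda>s. R s k - e s k))"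
          using \<phi>_\<Psi>[OF k, of \<delta>] by (simp add: \<delta>_def)
        also have "cmod \<dots> \<le> K * nrm ?Y (Inl (\<lambda>s. R s k - e s k))"
          by (rule \<phi>_le[OF _ k]) (simp add: D)
        also have "\<dots> \<le> K * (2 * pi / m)"
        proof (rule mult_left_mono)
          have "cmod (R s k - e s k) \<le> 2 * pi / m" for s
            using \<rho>(2)[OF norm_e[OF k], of s] by (simp add: R_def norm_minus_commute)
          then show "nrm ?Y (Inl (\<lambda>s. R s k - e s k)) \<le> 2 * pi / m"
            by (simp, intro cSUP_least) auto
        qed (simp add: K_def)
        finally show ?thesis .
      qed
      have upper: "cmod (\<Sum>k\<in>J. c k * \<phi> k (Inl (\<lambda>s. R s k))) \<le> b"
      proof -
        have "(\<Sum>k\<in>J. c k * \<phi> k (Inl (\<lambda>s. R s k))) = grid_mean J m (\<lambda>w. \<Sum>k\<in>J. w k * \<phi> k (Inl (h w)))"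
          by (simp add: grid_mean_sum avg)
        also have "cmod \<dots> \<le> grid_mean J m (\<lambda>w. cmod (\<Sum>k\<in>J. w k * \<phi> k (Inl (h w))))"
          by (rule norm_grid_mean)
        also have "\<dots> \<le> grid_mean J m (\<lambda>w. b)"
        proof (rule grid_mean_mono)
          fix w assume w: "w \<in> grid J m"
          have "cmod (\<Sum>k\<in>J. w k * \<phi> k (Inl (h w))) \<le> (\<Sum>k\<in>J. cmod (\<phi> k (Inl (h w))))"
            by (rule sum_norm_le) (simp add: norm_mult root[OF w])
          also have "\<dots> = nrm ?Y (P (Inl (h w)))" by (rule nrm_P[symmetric]) (simp add: h_bdd)
          also have "\<dots> \<le> b" by (rule b[OF _ h_nrm]) (simp add: h_bdd)
          finally show "cmod (\<Sum>k\<in>J. w k * \<phi> k (Inl (h w))) \<le> b" .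
        qed
        also have "\<dots> = b" by (rule grid_mean_const[OF finite_J m])
        finally show ?thesis .
      qed
      have "cmod ((\<Sum>k\<in>J. c k * \<phi> k (Inl (\<lambda>s. R s k))) - (\<Sum>k\<in>J. c k)) =
            cmod (\<Sum>k\<in>J. c k * (\<phi> k (Inl (\<lambda>s. R s k)) - 1))"
        by (simp add: right_diff_distrib sum_subtractf)
      also have "\<dots> \<le> (\<Sum>k\<in>J. K * (2 * pi / m))"
      proof (rule sum_norm_le)
        fix k assume k: "k \<in> J"
        have "cmod (c k) * cmod (\<phi> k (Inl (\<lambda>s. R s k)) - 1) \<le> 1 * (K * (2 * pi / m))"
          by (intro mult_mono c_norm near k) auto
        then show "cmod (c k * (\<phi> k (Inl (\<lambda>s. R s k)) - 1)) \<le> K * (2 * pi / m)" by (simp add: norm_mult)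
      qed
      finally have "cmod (\<Sum>k\<in>J. c k) \<le> b + card J * (K * (2 * pi / m))"
        using upper norm_triangle_ineq2[of "\<Sum>k\<in>J. c k" "\<Sum>k\<in>J. c k * \<phi> k (Inl (\<lambda>s. R s k))"]
        by (simp add: norm_minus_commute)
      then have "grid_mean J m (\<lambda>g. cmod (\<Sum>n\<in>J. g n)) \<le> b + card J * (K * (2 * pi / m))"
        unfolding sum_c norm_of_real by linarith
      moreover have "card J * (1 + K) * (2 * pi) / real m = card J * (2 * pi / m) + card J * (K * (2 * pi / m))"
        by (simp add: algebra_simps add_divide_distrib)
      ultimately show ?thesis using grid_mean_torus_close[OF finite_J m] by linarith
    qed
    have "(\<lambda>m. b + card J * (1 + K) * (2 * pi) / real m) \<longlonglongrightarrow> b + 0"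
      by (intro tendsto_add tendsto_const lim_const_over_n)
    then have "?C \<le> b + 0"
      by (rule tendsto_lowerbound) (use main in \<open>auto simp: eventually_sequentially intro!: exI[of _ 1]\<close>)
    then show ?thesis using real by (simp add: ennreal_leI)
  qed simp
qed

end

section \<open>Dirichlet polynomials\<close>

definition character :: "(nat \<Rightarrow> real) \<Rightarrow> real \<Rightarrow> nat \<Rightarrow> complex" where
  "character \<omega> t n = cis (- (\<omega> n * t))"

lemma norm_character [simp]: "cmod (character \<omega> t n) = 1"
  by (simp add: character_def)

lemma dirichlet_poly_imaginary:
  "dirichlet_poly \<omega> J a (\<i> * complex_of_real t) = (\<Sum>n\<in>J. a n * character \<omega> t n)"
  by (simp add: dirichlet_poly_def character_def cis_conv_exp mult_ac)

lemma int_independent_frequencies: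
  assumes ind: "rat_lin_indep \<omega>" and J: "J \<subseteq> {1..}"
  shows "module.independent (\<lambda>r. (*) (real_of_int r)) (\<omega> ` J)"
proof -
  interpret Q: Modules.module "\<lambda>q::rat. (*) (of_rat q :: real)"
    by (simp add: Modules.module.intro distrib_left mult.commute of_rat_add of_rat_mult)
  interpret Z: Modules.module "\<lambda>r. (*) (real_of_int r)"
    by (simp add: Modules.module.intro distrib_left mult.commute)
  show ?thesis
    unfolding Z.independent_explicit_module
  proof (intro allI impI)
    fix T and u :: "real \<Rightarrow> int" and v
    assume T: "finite T" "T \<subseteq> \<omega> ` J" and sum: "(\<Sum>v\<in>T. real_of_int (u v) * v) = 0" and v: "v \<in> T"
    have "T \<subseteq> \<omega> ` {1..}" using T J by blast
    from Q.independentD[OF ind[unfolded rat_lin_indep_def] T(1) this, of "\<lambda>v. of_int (u v)" v] sum v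
    show "u v = 0" by simp
  qed
qed

text \<open>
  Kronecker's theorem measures angles in full turns, hence the factors \<open>2 \<pi>\<close>, and wants the
  frequencies enumerated by an initial segment of the natural numbers.
\<close>

lemma character_approximation:
  assumes freq: "frequency \<omega>" and ind: "rat_lin_indep \<omega>"
    and J: "finite J" "J \<subseteq> {1..}" and u: "\<And>n. n \<in> J \<Longrightarrow> cmod (u n) = 1" and \<epsilon>: "\<epsilon> > 0"
  obtains t where "\<And>n. n \<in> J \<Longrightarrow> cmod (character \<omega> t n - u n) \<le> \<epsilon>"
proof -
  obtain h where h: "bij_betw h {0..<card J} J" using ex_bij_betw_nat_finite[OF J(1)] by blast
  define \<theta> where "\<theta> i = \<omega> (h i)" for i
  define \<alpha> where "\<alpha> i = - Arg (u (h i)) / (2 * pi)" for i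
  have img: "\<theta> ` {..<card J} = \<omega> ` J"
    using bij_betw_imp_surj_on[OF h] by (auto simp: \<theta>_def image_image[symmetric] lessThan_atLeast0)
  have "inj_on \<omega> {1..}" using freq unfolding frequency_def by (blast intro: strict_mono_on_imp_inj_on)
  then have "inj_on \<omega> J" using J(2) by (rule inj_on_subset)
  then have inj: "inj_on \<theta> {..<card J}"
    using comp_inj_on[OF bij_betw_imp_inj_on[OF h], of \<omega>] bij_betw_imp_surj_on[OF h]
    by (simp add: \<theta>_def[abs_def] comp_def lessThan_atLeast0)
  obtain t k where tk: "\<And>i. i < card J \<Longrightarrow> \<bar>t * \<theta> i - of_int (k i) - \<alpha> i\<bar> < \<epsilon> / (2 * pi)"
    by (rule Kronecker_thm_1[of \<theta> "card J" "\<epsilon> / (2 * pi)" \<alpha>])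
       (use int_independent_frequencies[OF ind J(2)] inj \<epsilon> in \<open>auto simp: img\<close>)
  show thesis
  proof
    fix n assume n: "n \<in> J"
    then have "n \<in> h ` {0..<card J}" using bij_betw_imp_surj_on[OF h] by simp
    then obtain i where i: "i < card J" "n = h i" by auto
    have "cis (Arg (u n)) = u n" using cis_Arg[of "u n"] u[OF n] by (cases "u n = 0") (auto simp: sgn_eq)
    then have u_eq: "u n = cis (- (2 * pi * \<alpha> i))" by (simp add: \<alpha>_def i)
    have "character \<omega> (2 * pi * t) n = cis (- (2 * pi * (t * \<theta> i - of_int (k i))))"
    proof -
      have "cis (- (2 * pi * (t * \<theta> i - of_int (k i)))) = cis (- (\<omega> n * (2 * pi * t))) * cis (2 * pi * of_int (k i))"
        by (simp add: cis_mult \<theta>_def i algebra_simps del: cis_multiple_2pi)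
      then show ?thesis by (simp add: character_def)
    qed
    then have "cmod (character \<omega> (2 * pi * t) n - u n)
        \<le> \<bar>- (2 * pi * (t * \<theta> i - of_int (k i))) - (- (2 * pi * \<alpha> i))\<bar>"
      unfolding u_eq using norm_cis_diff_le by presburger
    also have "\<dots> = 2 * pi * \<bar>t * \<theta> i - of_int (k i) - \<alpha> i\<bar>"
    proof -
      have "- (2 * pi * (t * \<theta> i - of_int (k i))) - (- (2 * pi * \<alpha> i)) =
          - (2 * pi * (t * \<theta> i - of_int (k i) - \<alpha> i))"
        by (simp add: algebra_simps)
      then show ?thesis by (simp only: abs_minus_cancel abs_mult) simp
    qed
    also have "\<dots> \<le> 2 * pi * (\<epsilon> / (2 * pi))"
      using tk[OF i(1)] by (intro mult_left_mono) auto
    finally show "cmod (character \<omega> (2 * pi * t) n - u n) \<le> \<epsilon>" by simp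
  qed
qed

text \<open>
  All summands \<open>a\<^sub>n exp (-\<i> \<omega>\<^sub>n t)\<close> can be brought close to the positive real axis by the same \<open>t\<close>.
\<close>

lemma bohr_sup_norm:
  assumes freq: "frequency \<omega>" and ind: "rat_lin_indep \<omega>" and J: "finite J" "J \<subseteq> {1..}"
  shows "(SUP t. cmod (\<Sum>n\<in>J. a n * character \<omega> t n)) = (\<Sum>n\<in>J. cmod (a n))"
proof (rule antisym)
  have le: "cmod (\<Sum>n\<in>J. a n * character \<omega> t n) \<le> (\<Sum>n\<in>J. cmod (a n))" for t
    by (rule sum_norm_le) (simp add: norm_mult)
  then have bdd: "bdd_above (range (\<lambda>t. cmod (\<Sum>n\<in>J. a n * character \<omega> t n)))"
    by (intro bdd_aboveI2)
  show "(SUP t. cmod (\<Sum>n\<in>J. a n * character \<omega> t n)) \<le> (\<Sum>n\<in>J. cmod (a n))"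
    by (rule cSUP_least) (use le in auto)
  show "(\<Sum>n\<in>J. cmod (a n)) \<le> (SUP t. cmod (\<Sum>n\<in>J. a n * character \<omega> t n))"
  proof (rule field_le_epsilon)
    fix \<epsilon> :: real assume \<epsilon>: "\<epsilon> > 0"
    let ?A = "\<Sum>n\<in>J. cmod (a n)"
    have A: "?A \<ge> 0" by (simp add: sum_nonneg)
    have "\<forall>n. \<exists>u. cmod u = 1 \<and> u * a n = cmod (a n)" using unimodular_rotation by metis
    then obtain u where u: "\<And>n. cmod (u n) = 1" "\<And>n. u n * a n = cmod (a n)" by metis
    obtain t where t: "\<And>n. n \<in> J \<Longrightarrow> cmod (character \<omega> t n - u n) \<le> \<epsilon> / (?A + 1)"
      using character_approximation[OF freq ind J, of u "\<epsilon> / (?A + 1)"] u \<epsilon> A by (auto simp: divide_pos_pos)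
    have "cmod ((\<Sum>n\<in>J. a n * u n) - (\<Sum>n\<in>J. a n * character \<omega> t n)) =
          cmod (\<Sum>n\<in>J. a n * (u n - character \<omega> t n))"
      by (simp add: sum_subtractf right_diff_distrib)
    also have "\<dots> \<le> (\<Sum>n\<in>J. cmod (a n) * (\<epsilon> / (?A + 1)))"
      by (rule sum_norm_le)
         (simp only: norm_mult norm_minus_commute[of "u _"], intro mult_left_mono t, auto)
    also have "\<dots> = ?A * (\<epsilon> / (?A + 1))" by (rule sum_distrib_right[symmetric])
    also have "\<dots> \<le> \<epsilon>"
      using A \<epsilon> by (simp add: field_simps)
    finally have close: "cmod ((\<Sum>n\<in>J. a n * u n) - (\<Sum>n\<in>J. a n * character \<omega> t n)) \<le> \<epsilon>" .
    have "(\<Sum>n\<in>J. a n * u n) = complex_of_real ?A" using u(2) by (simp add: mult.commute)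
    then have "?A = cmod (\<Sum>n\<in>J. a n * u n)" using A by (simp only: norm_of_real abs_of_nonneg)
    also have "\<dots> \<le> cmod (\<Sum>n\<in>J. a n * character \<omega> t n) + \<epsilon>"
      using close norm_triangle_ineq2[of "\<Sum>n\<in>J. a n * u n" "\<Sum>n\<in>J. a n * character \<omega> t n"] by linarith
    also have "cmod (\<Sum>n\<in>J. a n * character \<omega> t n) \<le> (SUP t. cmod (\<Sum>n\<in>J. a n * character \<omega> t n))"
      by (rule cSUP_upper[OF UNIV_I bdd])
    finally show "?A \<le> (SUP t. cmod (\<Sum>n\<in>J. a n * character \<omega> t n)) + \<epsilon>" by simp
  qed
qed

lemma dirichlet_space_simps [simp]:
  "carrier (dirichlet_space \<omega> J) = range (dirichlet_poly \<omega> J)"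
  "D \<oplus>\<^bsub>dirichlet_space \<omega> J\<^esub> E = (\<lambda>s. D s + E s)"
  "c \<odot>\<^bsub>dirichlet_space \<omega> J\<^esub> D = (\<lambda>s. c * D s)"
  "nrm (dirichlet_space \<omega> J) D = (SUP t::real. cmod (D (\<i> * complex_of_real t)))"
  by (simp_all add: dirichlet_space_def)

lemma dirichlet_poly_add:
  "dirichlet_poly \<omega> J (\<lambda>n. a n + b n) = (\<lambda>s. dirichlet_poly \<omega> J a s + dirichlet_poly \<omega> J b s)"
  by (rule ext) (simp add: dirichlet_poly_def distrib_right sum.distrib)

lemma dirichlet_poly_scale:
  "dirichlet_poly \<omega> J (\<lambda>n. c * a n) = (\<lambda>s. c * dirichlet_poly \<omega> J a s)"
  by (rule ext) (simp add: dirichlet_poly_def sum_distrib_left mult.assoc)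

text \<open>
  The upper bound holds in every superspace. For the lower bound a Dirichlet polynomial is sent
  to the function \<open>s \<mapsto> D (\<i> Im s)\<close> on the complex plane, so that the superspace of bounded
  functions is carried by the type of the Dirichlet polynomials itself.
\<close>

theorem proj_const_dirichlet_space:
  assumes freq: "frequency \<omega>" and ind: "rat_lin_indep \<omega>" and J: "finite J" "J \<subseteq> {1..}"
  shows "proj_const TYPE('y) (dirichlet_space \<omega> J) = ennreal (\<integral>z. cmod (\<Sum>n\<in>J. z n) \<partial>torus J)"
proof (rule antisym)
  let ?E = "dirichlet_space \<omega> J" and ?D = "dirichlet_poly \<omega> J"
  let ?C = "ennreal (\<integral>z. cmod (\<Sum>n\<in>J. z n) \<partial>torus J)"
  have nrm_D: "nrm ?E (?D a) = (\<Sum>n\<in>J. cmod (a n))" for a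
    by (simp add: dirichlet_poly_imaginary bohr_sup_norm[OF freq ind J])
  show "proj_const TYPE('y) ?E \<le> ?C"
    unfolding proj_const_def
  proof (rule SUP_least, clarify)
    fix Y :: "((complex \<Rightarrow> complex) + 'y) normed_module" and I
    assume Y: "complex_banach_space Y" and I: "I \<in> isometric_embeddings ?E Y"
    have I_carrier: "I (?D a) \<in> carrier Y" for a
      using I by (auto simp: isometric_embeddings_def linear_maps_def Pi_def)
    have I_add: "I (?D a \<oplus>\<^bsub>?E\<^esub> ?D b) = I (?D a) \<oplus>\<^bsub>Y\<^esub> I (?D b)" for a b
      using I unfolding isometric_embeddings_def linear_maps_def by (simp del: dirichlet_space_simps(2-4))
    have I_scale: "I (c \<odot>\<^bsub>?E\<^esub> ?D a) = c \<odot>\<^bsub>Y\<^esub> I (?D a)" for c a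
      using I unfolding isometric_embeddings_def linear_maps_def by (simp del: dirichlet_space_simps(2-4))
    have I_nrm: "nrm Y (I (?D a)) = nrm ?E (?D a)" for a
      using I unfolding isometric_embeddings_def by (simp del: dirichlet_space_simps(2-4))
    have "l1_subspace Y J (\<lambda>a. I (?D a))"
    proof (rule l1_subspace.intro[OF Y], unfold_locales)
      show "I (?D (\<lambda>n. a n + b n)) = I (?D a) \<oplus>\<^bsub>Y\<^esub> I (?D b)" for a b
        using I_add[of a b] by (simp add: dirichlet_poly_add)
      show "I (?D (\<lambda>n. c * a n)) = c \<odot>\<^bsub>Y\<^esub> I (?D a)" for c a
        using I_scale[of c a] by (simp add: dirichlet_poly_scale)
      show "nrm Y (I (?D a)) = (\<Sum>n\<in>J. cmod (a n))" for a
        using I_nrm[of a] nrm_D by simp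
    qed (fact J I_carrier)+
    from l1_subspace.rel_proj_const_le[OF this]
    show "rel_proj_const (I ` carrier ?E) Y \<le> ?C" by (simp add: image_image)
  qed
  show "?C \<le> proj_const TYPE('y) ?E"
  proof -
    let ?Y = "bounded_functions :: ((complex \<Rightarrow> complex) + 'y) normed_module"
    define I :: "(complex \<Rightarrow> complex) \<Rightarrow> (complex \<Rightarrow> complex) + 'y"
      where "I x = Inl (\<lambda>s. x (\<i> * complex_of_real (Im s)))" for x
    interpret unimodular_l1_system J "\<lambda>s::complex. character \<omega> (Im s)"
    proof
      fix a :: "nat \<Rightarrow> complex"
      have "range (\<lambda>s. cmod (\<Sum>n\<in>J. a n * character \<omega> (Im s) n)) = range (\<lambda>t. cmod (\<Sum>n\<in>J. a n * character \<omega> t n))"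
        by (auto simp: image_iff) (metis Im_i_times Re_complex_of_real)
      then show "(SUP s. cmod (\<Sum>n\<in>J. a n * character \<omega> (Im s) n)) = (\<Sum>n\<in>J. cmod (a n))"
        using bohr_sup_norm[OF freq ind J, of a] by simp
    qed (use J in auto)
    interpret S: l1_subspace ?Y J \<Psi> by (rule l1_subspace_\<Psi>)
    have I_D: "I (?D a) = \<Psi> a" for a
      by (simp add: I_def \<Psi>_def dirichlet_poly_imaginary)
    have range: "I ` carrier ?E = range \<Psi>" by (simp add: image_image I_D)
    have "I \<in> linear_maps ?E ?Y"
      unfolding linear_maps_def
    proof (intro CollectI conjI ballI allI)
      show "I \<in> carrier ?E \<rightarrow> carrier ?Y" using range S.range_\<Psi>_subspace(1) by blast
    qed (simp_all add: I_def)
    moreover have "nrm ?Y (I x) = nrm ?E x" if "x \<in> carrier ?E" for x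
    proof -
      from that obtain a where x: "x = ?D a" by auto
      show ?thesis unfolding x I_D nrm_D by (rule S.nrm_\<Psi>)
    qed
    ultimately have "I \<in> isometric_embeddings ?E ?Y"
      unfolding isometric_embeddings_def by blast
    moreover have "complemented (I ` carrier ?E) ?Y"
      unfolding complemented_def range using S.grid_projection[of 2] by auto
    ultimately have "rel_proj_const (I ` carrier ?E) ?Y \<le> proj_const TYPE('y) ?E"
      unfolding proj_const_def using complex_banach_space_bounded_functions
      by (intro SUP_upper2[of "(?Y, I)"]) auto
    moreover have "?C \<le> rel_proj_const (I ` carrier ?E) ?Y"
      unfolding rel_proj_const_def range by (rule INF_greatest) (rule op_norm_ge)
    ultimately show ?thesis by (rule order_trans[rotated])
  qed
qed

theorem theorem3p8:
  fixes \<omega> :: "nat \<Rightarrow> real"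
  assumes "frequency \<omega>" and "rat_lin_indep \<omega>"
  shows "(\<forall>J. finite J \<and> J \<subseteq> {1..} \<longrightarrow>
            proj_const TYPE('y) (dirichlet_space \<omega> J) =
            ennreal (\<integral>z. cmod (\<Sum>n\<in>J. z n) \<partial>(\<Pi>\<^sub>M n\<in>J. circle_measure))) \<and>
         ((\<lambda>x. proj_const TYPE('y) (dirichlet_space \<omega> {1..x}) / ennreal (sqrt (real x)))
            \<longlonglongrightarrow> ennreal (sqrt pi / 2))"
proof (intro conjI allI impI)
  fix J :: "nat set" assume "finite J \<and> J \<subseteq> {1..}"
  then show "proj_const TYPE('y) (dirichlet_space \<omega> J) =
      ennreal (\<integral>z. cmod (\<Sum>n\<in>J. z n) \<partial>(\<Pi>\<^sub>M n\<in>J. circle_measure))"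
    using proj_const_dirichlet_space[OF assms] by blast
next
  have "(\<lambda>x. ennreal ((\<integral>z. cmod (\<Sum>n\<in>{1..x}. z n) \<partial>torus {1..x}) / sqrt (real x)))
      \<longlonglongrightarrow> ennreal (sqrt pi / 2)"
    by (intro tendsto_ennrealI torus_mean_norm_asymptotics)
  moreover have "eventually (\<lambda>x. ennreal ((\<integral>z. cmod (\<Sum>n\<in>{1..x}. z n) \<partial>torus {1..x}) / sqrt (real x)) =
      proj_const TYPE('y) (dirichlet_space \<omega> {1..x}) / ennreal (sqrt (real x))) sequentially"
    using eventually_gt_at_top[of 0]
    by eventually_elim (simp add: proj_const_dirichlet_space[OF assms] divide_ennreal)
  ultimately show "(\<lambda>x. proj_const TYPE('y) (dirichlet_space \<omega> {1..x}) / ennreal (sqrt (real x)))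
      \<longlonglongrightarrow> ennreal (sqrt pi / 2)"
    by (rule Lim_transform_eventually)
qed

end
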